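(* Let $\Phi$ be a Young function with $\Phi\in\Delta_2$. Any norm bounded sequence $(\xi_n)_n$ in $L_{\Phi^*}$ admits a sequence of forward convex combinations $\bar\xi_n\in\operatorname{conv}(\xi_k;\,k\ge n)$, $n\geq 1$, as well as a $\xi\in L_{\Phi^*}$ such that $\bar\xi_n\to\xi$ in order, i.e. $\sup_n|\bar\xi_n|\in L_{\Phi^*}$ and $\bar\xi_n\to\xi$ a.s.
   Context: $(\Omega,\mathcal F,\mathbb P)$ is a probability space, $L_0$ is the space of $\mathbb P$-a.s. equivalence classes of finite real measurable functions, $\mathbb E$ is expectation. A (finite coercive) Young function is an even convex function $\Phi:\mathbb R\to\mathbb R$ with $\Phi(0)=0$ and $\lim_{x\to+\infty}\Phi(x)/x=+\infty$; its conjugate $\Phi^*(y)=\sup_x(xy-\Phi(x))$ is again such a function. $\Phi\in\Delta_2$ means $\limsup_{x\to\infty}\Phi(2x)/\Phi(x)<\infty$. For a Young function $\Psi$, $\mathbb B_\Psi=\{\xi\in L_0:\mathbb E[\Psi(\xi)]\le 1\}$, and the Orlicz space is $L_\Psi=\bigcup_{\lambda>0}\lambda\mathbb B_\Psi$ with norm $\|\xi\|_\Psi=\inf\{\lambda>0:\xi\in\lambda\mathbb B_\Psi\}$ and the a.s. pointwise order. $\operatorname{conv}$ denotes the convex hull (finite convex combinations). *)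

theory Defs
  imports "HOL-Probability.Probability"
begin

definition young_function :: "(real \<Rightarrow> real) \<Rightarrow> bool" where
  "young_function \<Phi> \<longleftrightarrow>
     (\<forall>x. \<Phi> (- x) = \<Phi> x) \<and> convex_on UNIV \<Phi> \<and> \<Phi> 0 = 0 \<and>
     filterlim (\<lambda>x. \<Phi> x / x) at_top at_top"

text \<open>For a Young function the supremum is over a set that is bounded above (by coercivity), so
  the supremum in the reals is the true one.\<close>
definition young_conjugate :: "(real \<Rightarrow> real) \<Rightarrow> real \<Rightarrow> real" where
  "young_conjugate \<Phi> y = (SUP x. x * y - \<Phi> x)"

definition Delta2 :: "(real \<Rightarrow> real) \<Rightarrow> bool" where
  "Delta2 \<Phi> \<longleftrightarrow> Limsup at_top (\<lambda>x. ereal (\<Phi> (2 * x) / \<Phi> x)) < \<infinity>"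

text \<open>Elements of \<open>L\<^sub>0\<close>, the space of almost sure equivalence classes of finite measurable
  functions, are given by representatives in \<^term>\<open>borel_measurable M\<close>. The notions below
  respect almost sure equality of representatives. Young functions are nonnegative, so the
  expectation is a nonnegative integral, which may be infinite.\<close>
definition orlicz_ball :: "'a measure \<Rightarrow> (real \<Rightarrow> real) \<Rightarrow> ('a \<Rightarrow> real) set" where
  "orlicz_ball M \<Psi> = {\<xi> \<in> borel_measurable M. (\<integral>\<^sup>+\<omega>. ennreal (\<Psi> (\<xi> \<omega>)) \<partial>M) \<le> 1}"

definition scaled_orlicz_ball ::
  "'a measure \<Rightarrow> (real \<Rightarrow> real) \<Rightarrow> real \<Rightarrow> ('a \<Rightarrow> real) set" where
  "scaled_orlicz_ball M \<Psi> c = (\<lambda>\<xi> \<omega>. c * \<xi> \<omega>) ` orlicz_ball M \<Psi>"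

definition orlicz_space :: "'a measure \<Rightarrow> (real \<Rightarrow> real) \<Rightarrow> ('a \<Rightarrow> real) set" where
  "orlicz_space M \<Psi> = (\<Union>c\<in>{0<..}. scaled_orlicz_ball M \<Psi> c)"

definition orlicz_norm :: "'a measure \<Rightarrow> (real \<Rightarrow> real) \<Rightarrow> ('a \<Rightarrow> real) \<Rightarrow> real" where
  "orlicz_norm M \<Psi> \<xi> = Inf {c. c > 0 \<and> \<xi> \<in> scaled_orlicz_ball M \<Psi> c}"

text \<open>The library's \<open>convex hull\<close> needs a \<open>real_vector\<close> type, which the function type is not.
  The set \<open>F\<close> is nonempty, since the weights sum to one.\<close>
definition fun_conv :: "('a \<Rightarrow> real) set \<Rightarrow> ('a \<Rightarrow> real) set" where
  "fun_conv S = {g. \<exists>F u. finite F \<and> F \<subseteq> S \<and> (\<forall>f\<in>F. 0 \<le> u f) \<and> sum u F = (1::real) \<and>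
     g = (\<lambda>\<omega>. \<Sum>f\<in>F. u f * f \<omega>)}"

text \<open>The pointwise supremum of representatives may be infinite on a null set. It is
  therefore taken in the extended reals, and its class lies in the Orlicz space if it agrees
  almost surely with some finite element \<open>\<sigma>\<close> of that space.\<close>
definition orlicz_order_convergent ::
  "'a measure \<Rightarrow> (real \<Rightarrow> real) \<Rightarrow> (nat \<Rightarrow> 'a \<Rightarrow> real) \<Rightarrow> ('a \<Rightarrow> real) \<Rightarrow> bool" where
  "orlicz_order_convergent M \<Psi> \<eta> \<xi> \<longleftrightarrow>
     (\<exists>\<sigma>\<in>orlicz_space M \<Psi>. AE \<omega> in M. (SUP n. ereal \<bar>\<eta> n \<omega>\<bar>) = ereal (\<sigma> \<omega>)) \<and>
     (AE \<omega> in M. (\<lambda>n. \<eta> n \<omega>) \<longlonglongrightarrow> \<xi> \<omega>)"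

end

theory Submission imports Defs begin

text \<open>Let \<open>\<Psi>\<close> be the conjugate of \<open>\<Phi>\<close>, scaled so that the given sequence has \<open>E \<Psi>(\<xi>\<^sub>n) \<le> 1\<close>.
  Almost minimising \<open>E sqrt (1 + \<eta>\<^sup>2)\<close> over the convex hulls of the tails gives, by strict convexity,
  forward convex combinations that converge almost surely to some \<open>\<zeta>\<close>. Half their differences to
  \<open>\<zeta>\<close> form a sequence \<open>z\<^sub>n\<close> with \<open>E \<Psi>(z\<^sub>n) \<le> 1\<close> that tends to 0 almost surely.

  The condition \<open>\<Phi> \<in> \<Delta>\<^sub>2\<close> gives, for every \<open>\<epsilon> > 0\<close>, some \<open>N\<close> and \<open>C\<close> with
  \<open>N \<Psi>(y / N) \<le> \<epsilon> \<Psi>(y) + C\<close>. Choose \<open>N\<close> terms of \<open>z\<close> whose large parts have small probability and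
  are almost disjointly supported. For an average of \<open>N\<close> disjointly supported functions, \<open>E \<Psi>\<close>
  is the sum of the terms \<open>E \<Psi>(z\<^sub>i / N)\<close>, hence of order \<open>\<epsilon>\<close>, so the part of \<open>\<Psi>\<close> of a third of the
  average that exceeds \<open>\<Psi>(1)\<close> has small expectation. With \<open>\<epsilon> = 2\<^sup>-\<^sup>n\<close> these excesses are summable,
  which bounds the supremum of the averages.\<close>

section \<open>Convex combinations and even convex functions\<close>

lemma fun_conv_base: "f \<in> S \<Longrightarrow> f \<in> fun_conv S"
  unfolding fun_conv_def by (auto intro!: exI[of _ "{f}"] exI[of _ "\<lambda>_. 1"])

lemma fun_conv_mono: "S \<subseteq> T \<Longrightarrow> fun_conv S \<subseteq> fun_conv T"
  unfolding fun_conv_def by blast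

text \<open>Weights are indexed by functions, so both families are extended by zero to the union of
  their finite sets; a function that occurs in both gets the combined weight.\<close>

lemma fun_conv_convex:
  assumes g: "g \<in> fun_conv S" and h: "h \<in> fun_conv S" and s: "0 \<le> s" "0 \<le> t" "s + t = 1"
  shows "(\<lambda>\<omega>. s * g \<omega> + t * h \<omega>) \<in> fun_conv S"
proof -
  obtain F u where F: "finite F" "F \<subseteq> S" "\<forall>f\<in>F. 0 \<le> u f" "sum u F = 1"
    "g = (\<lambda>\<omega>. \<Sum>f\<in>F. u f * f \<omega>)"
    using g unfolding fun_conv_def by blast
  obtain G v where G: "finite G" "G \<subseteq> S" "\<forall>f\<in>G. 0 \<le> v f" "sum v G = 1"
    "h = (\<lambda>\<omega>. \<Sum>f\<in>G. v f * f \<omega>)"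
    using h unfolding fun_conv_def by blast
  define u' where "u' f = (if f \<in> F then u f else 0)" for f
  define v' where "v' f = (if f \<in> G then v f else 0)" for f
  define w where "w f = s * u' f + t * v' f" for f
  have Fu: "(\<Sum>f\<in>F \<union> G. u' f * c f) = (\<Sum>f\<in>F. u f * c f)" for c
    using F(1) G(1) by (intro sum.mono_neutral_cong_right) (auto simp: u'_def)
  have Gv: "(\<Sum>f\<in>F \<union> G. v' f * c f) = (\<Sum>f\<in>G. v f * c f)" for c
    using F(1) G(1) by (intro sum.mono_neutral_cong_right) (auto simp: v'_def)
  have w: "(\<Sum>f\<in>F \<union> G. w f * c f) = s * (\<Sum>f\<in>F. u f * c f) + t * (\<Sum>f\<in>G. v f * c f)" for c
    unfolding Fu[symmetric] Gv[symmetric] w_def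
    by (simp add: algebra_simps sum.distrib sum_distrib_left)
  have "sum w (F \<union> G) = 1"
    using w[of "\<lambda>_. 1"] F(4) G(4) s by simp
  moreover have "\<forall>f\<in>F \<union> G. 0 \<le> w f"
    using F(3) G(3) s by (auto simp: w_def u'_def v'_def)
  ultimately show ?thesis
    unfolding fun_conv_def F(5) G(5) mem_Collect_eq w[symmetric]
    using F(1,2) G(1,2) by (intro exI[of _ "F \<union> G"] exI[of _ w]) auto
qed

text \<open>Induction on \<open>N\<close>: the new average gives weight \<open>N / Suc N\<close> to
  the old one. The indexed family \<open>g\<close> may repeat functions.\<close>

lemma fun_conv_average:
  fixes N :: nat
  assumes "N > 0" and "\<And>i. i < N \<Longrightarrow> g i \<in> fun_conv S"
  shows "(\<lambda>\<omega>. (\<Sum>i<N. g i \<omega>) / N) \<in> fun_conv S"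
  using assms
proof (induction N rule: nat_induct_non_zero)
  case 1
  then show ?case by simp
next
  case (Suc N)
  have "(\<lambda>\<omega>. (real N / real (Suc N)) * ((\<Sum>i<N. g i \<omega>) / N) + (1 / real (Suc N)) * g N \<omega>) \<in> fun_conv S"
    using Suc by (intro fun_conv_convex) (auto simp: field_simps)
  also have "(\<lambda>\<omega>. (real N / real (Suc N)) * ((\<Sum>i<N. g i \<omega>) / N) + (1 / real (Suc N)) * g N \<omega>)
      = (\<lambda>\<omega>. (\<Sum>i<Suc N. g i \<omega>) / Suc N)"
    using Suc.hyps by (auto simp: add_divide_distrib)
  finally show ?case .
qed

text \<open>Young functions, their conjugates and the rescalings of both satisfy these conditions,
  so one set of facts serves all of them.\<close>

locale even_convex =
  fixes \<psi> :: "real \<Rightarrow> real"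
  assumes even: "\<psi> (- x) = \<psi> x"
    and convex: "convex_on UNIV \<psi>"
    and zero: "\<psi> 0 = 0"
begin

lemma combine: "0 \<le> u \<Longrightarrow> 0 \<le> v \<Longrightarrow> u + v = 1 \<Longrightarrow> \<psi> (u * x + v * y) \<le> u * \<psi> x + v * \<psi> y"
  using convex by (simp add: convex_on_def)

lemma nonneg: "0 \<le> \<psi> x"
  using combine[of "1/2" "1/2" x "- x"] by (simp add: even zero)

lemma abs: "\<psi> \<bar>x\<bar> = \<psi> x"
  by (cases "0 \<le> x") (auto simp: even)

lemma scale: "0 \<le> u \<Longrightarrow> u \<le> 1 \<Longrightarrow> \<psi> (u * x) \<le> u * \<psi> x"
  using combine[of u "1 - u" x 0] by (simp add: zero)

lemma mono:
  assumes "\<bar>x\<bar> \<le> \<bar>y\<bar>"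
  shows "\<psi> x \<le> \<psi> y"
proof (cases "y = 0")
  case False
  have "\<psi> x = \<psi> \<bar>x\<bar>" by (simp add: abs)
  also have "\<dots> \<le> (\<bar>x\<bar> / \<bar>y\<bar>) * \<psi> \<bar>y\<bar>"
    using scale[of "\<bar>x\<bar> / \<bar>y\<bar>" "\<bar>y\<bar>"] False assms by simp
  also have "\<dots> \<le> \<psi> \<bar>y\<bar>"
    using assms False nonneg[of "\<bar>y\<bar>"] by (intro mult_left_le_one_le) auto
  finally show ?thesis by (simp add: abs)
qed (use assms in auto)

lemma continuous: "continuous_on S \<psi>"
  using convex_on_continuous[OF open_UNIV convex] continuous_on_subset by blast

lemma measurable [measurable]: "\<psi> \<in> borel_measurable borel"
  using continuous by (rule borel_measurable_continuous_onI)

lemma average: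
  fixes N :: nat
  assumes "N > 0"
  shows "\<psi> ((\<Sum>i<N. x i) / N) \<le> (\<Sum>i<N. \<psi> (x i)) / N"
proof -
  have "\<psi> (\<Sum>i<N. (1 / real N) *\<^sub>R x i) \<le> (\<Sum>i<N. (1 / real N) * \<psi> (x i))"
    using assms by (intro convex_on_sum[OF _ _ convex]) auto
  then show ?thesis by (simp add: sum_divide_distrib)
qed

lemma rescale:
  assumes "c > 0"
  shows "even_convex (\<lambda>x. \<psi> (x / c))"
proof
  have "convex_on UNIV (\<lambda>x. \<psi> (x / c))"
    unfolding convex_on_def
  proof (intro conjI allI ballI impI)
    fix x y u v :: real
    assume "0 \<le> u" "0 \<le> v" "u + v = 1"
    then show "\<psi> ((u *\<^sub>R x + v *\<^sub>R y) / c) \<le> u * \<psi> (x / c) + v * \<psi> (y / c)"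
      using combine[of u v "x / c" "y / c"] by (simp add: add_divide_distrib)
  qed auto
  then show "convex_on UNIV (\<lambda>x. \<psi> (x / c))" .
qed (auto simp: even zero)

text \<open>If \<open>l\<close> is the last index with \<open>x\<^sub>l > 1\<close>, the average splits into terms at most 1, the term
  \<open>x\<^sub>l / N\<close>, and the terms with an index below \<open>l\<close>.\<close>
lemma average_split:
  fixes N :: nat
  assumes N: "N > 0" and x: "\<And>i. i < N \<Longrightarrow> 0 \<le> x i"
  shows "3 * \<psi> ((\<Sum>i<N. x i) / N / 3) \<le> \<psi> 1 + (\<Sum>i<N. of_bool (x i > 1) * \<psi> (x i / N))
     + (\<Sum>i<N. \<Sum>j\<in>{i<..<N}. of_bool (x j > 1) * \<psi> (x i))"
proof -
  let ?B = "\<Sum>i<N. of_bool (x i > 1) * \<psi> (x i / N)"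
  let ?D = "\<Sum>i<N. \<Sum>j\<in>{i<..<N}. of_bool (x j > 1) * \<psi> (x i)"
  \<comment> \<open>Jensen for three points of equal weight, encoded as a function on the indices 0,
    1, 2.\<close>
  have third: "3 * \<psi> ((a + b + c) / 3) \<le> \<psi> a + \<psi> b + \<psi> c" for a b c
    using average[of 3 "\<lambda>i. if i = 0 then a else if i = 1 then b else c"]
    by (simp add: numeral_3_eq_3)
  have B0: "0 \<le> ?B" and D0: "0 \<le> ?D"
    by (intro sum_nonneg mult_nonneg_nonneg nonneg; simp)+
  \<comment> \<open>\<open>b\<close> will be the last large term divided by \<open>N\<close> and
    \<open>d\<close> the contribution of the indices before it; the 1 absorbs the terms after it.
    Without a large term both are 0.\<close>
  have "\<exists>b d. (\<Sum>i<N. x i) / N \<le> 1 + b + d \<and> 0 \<le> b \<and> 0 \<le> d \<and> \<psi> b \<le> ?B \<and> \<psi> d \<le> ?D"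
  proof (cases "\<exists>i<N. x i > 1")
    case False
    then have "(\<Sum>i<N. x i) \<le> (\<Sum>i<N. 1)"
      by (intro sum_mono) force
    then have "(\<Sum>i<N. x i) / N \<le> 1 + 0 + 0"
      using N by (simp add: field_simps)
    then show ?thesis using B0 D0 by (intro exI[of _ 0]) (auto simp: zero)
  next
    case True
    define I where "I = {i. i < N \<and> x i > 1}"
    define l where "l = Max I"
    have finI: "finite I" unfolding I_def by simp
    have "l \<in> I"
      unfolding l_def using True finI by (intro Max_in) (auto simp: I_def)
    then have l: "l < N" "x l > 1" by (auto simp: I_def)
    have above: "x i \<le> 1" if "i < N" "l < i" for i
    proof (rule ccontr)
      assume "\<not> x i \<le> 1"
      then have "i \<in> I" using that(1) by (simp add: I_def)
      then have "i \<le> l" unfolding l_def by (rule Max_ge[OF finI])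
      then show False using that(2) by simp
    qed
    have "(\<Sum>i<N. x i) \<le> (\<Sum>i<N. 1 + (if i = l then x l else 0) + of_bool (i < l) * x i)"
      using above l x by (intro sum_mono) (auto simp: not_less of_bool_def less_le)
    also have "\<dots> = N + x l + (\<Sum>i<N. of_bool (i < l) * x i)"
      using l by (simp add: sum.distrib)
    finally have "(\<Sum>i<N. x i) / N \<le> (N + x l + (\<Sum>i<N. of_bool (i < l) * x i)) / N"
      by (rule divide_right_mono) simp
    also have "\<dots> = 1 + x l / N + (\<Sum>i<N. of_bool (i < l) * x i) / N"
      using N by (simp add: add_divide_distrib)
    finally have sum: "(\<Sum>i<N. x i) / N \<le> 1 + x l / N + (\<Sum>i<N. of_bool (i < l) * x i) / N" .
    have "\<psi> (x l / N) = of_bool (x l > 1) * \<psi> (x l / N)"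
      using l by simp
    also have "\<dots> \<le> ?B"
      using l by (intro member_le_sum) (auto intro: nonneg)
    finally have b: "\<psi> (x l / N) \<le> ?B" .
    \<comment> \<open>Jensen's factor 1 / N is given up afterwards: \<open>?D\<close> will be small
      through the sparse choice of indices, not through \<open>N\<close>.\<close>
    have "\<psi> ((\<Sum>i<N. of_bool (i < l) * x i) / N) \<le> (\<Sum>i<N. \<psi> (of_bool (i < l) * x i)) / N"
      by (rule average[OF N])
    also have "\<dots> \<le> (\<Sum>i<N. \<psi> (of_bool (i < l) * x i)) / 1"
      using N by (intro divide_left_mono) (auto intro!: sum_nonneg nonneg)
    also have "\<dots> \<le> ?D / 1"
    proof (intro divide_right_mono sum_mono)
      fix i assume i: "i \<in> {..<N}"
      show "\<psi> (of_bool (i < l) * x i) \<le> (\<Sum>j\<in>{i<..<N}. of_bool (x j > 1) * \<psi> (x i))"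
      proof (cases "i < l")
        case True
        \<comment> \<open>The summand \<open>j = l\<close> alone suffices, since
          \<open>x l > 1\<close>.\<close>
        then have "of_bool (x l > 1) * \<psi> (x i) \<le> (\<Sum>j\<in>{i<..<N}. of_bool (x j > 1) * \<psi> (x i))"
          using l by (intro member_le_sum) (auto intro: nonneg)
        then show ?thesis using True l by simp
      next
        case False
        have "0 \<le> (\<Sum>j\<in>{i<..<N}. of_bool (x j > 1) * \<psi> (x i))"
          by (intro sum_nonneg mult_nonneg_nonneg nonneg) simp
        then show ?thesis using False by (simp add: zero)
      qed
    qed simp
    finally have d: "\<psi> ((\<Sum>i<N. of_bool (i < l) * x i) / N) \<le> ?D" by simp
    show ?thesis
      using sum b d l x
      by (intro exI[of _ "x l / N"] exI[of _ "(\<Sum>i<N. of_bool (i < l) * x i) / N"])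
        (auto intro!: divide_nonneg_nonneg sum_nonneg)
  qed
  then obtain b d where bd: "(\<Sum>i<N. x i) / N \<le> 1 + b + d" "0 \<le> b" "0 \<le> d" "\<psi> b \<le> ?B" "\<psi> d \<le> ?D"
    by blast
  have "0 \<le> (\<Sum>i<N. x i) / N"
    using x by (intro divide_nonneg_nonneg sum_nonneg) auto
  then have "\<psi> ((\<Sum>i<N. x i) / N / 3) \<le> \<psi> ((1 + b + d) / 3)"
    using bd by (intro mono) auto
  then show ?thesis using third[of 1 b d] bd by linarith
qed

end

section \<open>Growth of the conjugate of a \<open>\<Delta>\<^sub>2\<close> function\<close>

lemma young_function_even_convex: "young_function \<Phi> \<Longrightarrow> even_convex \<Phi>"
  unfolding young_function_def by unfold_locales auto

section \<open>Duality between a Young function and its conjugate\<close>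

context
  fixes \<Phi> :: "real \<Rightarrow> real"
  assumes young: "young_function \<Phi>"
begin

interpretation \<Phi>: even_convex \<Phi>
  using young by (rule young_function_even_convex)

text \<open>By coercivity \<Phi> exceeds \<open>\<bar>y\<bar> * \<bar>x\<bar>\<close> outside a
  bounded interval, so the difference is nonpositive there; inside, \<Phi> \<ge> 0 leaves only the
  linear term.\<close>

lemma young_conjugate_bdd: "bdd_above (range (\<lambda>x. x * y - \<Phi> x))"
proof -
  have "eventually (\<lambda>x. \<Phi> x / x \<ge> \<bar>y\<bar>) at_top"
    using young unfolding young_function_def filterlim_at_top by blast
  then obtain b where b: "\<And>x. x \<ge> b \<Longrightarrow> \<Phi> x / x \<ge> \<bar>y\<bar>"
    unfolding eventually_at_top_linorder by blast
  define c where "c = max b 1"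
  have "x * y - \<Phi> x \<le> c * \<bar>y\<bar>" for x
  proof (cases "\<bar>x\<bar> \<ge> c")
    case True
    then have "\<bar>y\<bar> * \<bar>x\<bar> \<le> \<Phi> \<bar>x\<bar>" "\<bar>x\<bar> > 0"
      using b[of "\<bar>x\<bar>"] by (auto simp: c_def field_simps split: if_splits)
    moreover have "x * y \<le> \<bar>y\<bar> * \<bar>x\<bar>"
      by (metis abs_ge_self abs_mult mult.commute)
    moreover have "0 \<le> c * \<bar>y\<bar>" by (simp add: c_def)
    ultimately show ?thesis by (simp add: \<Phi>.abs)
  next
    case False
    have "x * y \<le> \<bar>x\<bar> * \<bar>y\<bar>"
      by (metis abs_ge_self abs_mult)
    also have "\<dots> \<le> c * \<bar>y\<bar>" using False by (intro mult_right_mono) auto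
    finally show ?thesis using \<Phi>.nonneg[of x] by linarith
  qed
  then show ?thesis by (intro bdd_aboveI) auto
qed

lemma fenchel_young: "x * y - \<Phi> x \<le> young_conjugate \<Phi> y"
  unfolding young_conjugate_def by (intro cSUP_upper young_conjugate_bdd) simp

lemma young_conjugate_le: "(\<And>x. x * y - \<Phi> x \<le> c) \<Longrightarrow> young_conjugate \<Phi> y \<le> c"
  unfolding young_conjugate_def by (intro cSUP_least) auto

text \<open>A supremum of functions affine in \<open>y\<close> is convex; evenness comes from
  substituting \<open>- x\<close> for \<open>x\<close>.\<close>

lemma young_conjugate_even_convex: "even_convex (young_conjugate \<Phi>)"
proof
  have le: "young_conjugate \<Phi> (- y) \<le> young_conjugate \<Phi> y" for y
    using fenchel_young[of "- x" y for x] by (intro young_conjugate_le) (simp add: \<Phi>.even)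
  show "young_conjugate \<Phi> (- y) = young_conjugate \<Phi> y" for y
    using le[of y] le[of "- y"] by simp
  show "convex_on UNIV (young_conjugate \<Phi>)"
    unfolding convex_on_def
  proof (intro conjI allI ballI impI)
    fix y z u v :: real
    assume uv: "0 \<le> u" "0 \<le> v" "u + v = 1"
    show "young_conjugate \<Phi> (u *\<^sub>R y + v *\<^sub>R z) \<le> u * young_conjugate \<Phi> y + v * young_conjugate \<Phi> z"
    proof (rule young_conjugate_le)
      fix x
      have "x * (u *\<^sub>R y + v *\<^sub>R z) - \<Phi> x = u * (x * y - \<Phi> x) + v * (x * z - \<Phi> x)"
        using distrib_right[of u v "\<Phi> x"] uv(3) by (simp add: algebra_simps)
      also have "\<dots> \<le> u * young_conjugate \<Phi> y + v * young_conjugate \<Phi> z"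
        using uv by (intro add_mono mult_left_mono fenchel_young)
      finally show "x * (u *\<^sub>R y + v *\<^sub>R z) - \<Phi> x \<le> u * young_conjugate \<Phi> y + v * young_conjugate \<Phi> z" .
    qed
  qed auto
  show "young_conjugate \<Phi> 0 = 0"
    using young_conjugate_le[of 0 0] fenchel_young[of 0 0] \<Phi>.nonneg by (auto simp: \<Phi>.zero intro: antisym)
qed

interpretation \<Psi>: even_convex "young_conjugate \<Phi>"
  by (rule young_conjugate_even_convex)

text \<open>Fenchel-Young at the point 1. This linear lower bound later turns a bound on the modular
  into a bound in L1.\<close>

lemma abs_le_young_conjugate: "\<bar>y\<bar> \<le> \<Phi> 1 + young_conjugate \<Phi> y"
  using fenchel_young[of 1 "\<bar>y\<bar>"] by (simp add: \<Psi>.abs)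

text \<open>Doubling is controlled for large arguments only; the additive \<open>C\<close> covers
  the bounded ones. The factor is written \<open>2 * L\<close> with a natural number
  \<open>L\<close> so that \<open>L ^ k\<close> can later count the terms of an average.\<close>

lemma Delta2_power:
  assumes "Delta2 \<Phi>"
  obtains L :: nat where "L \<ge> 1" "\<And>k. \<exists>C\<ge>0. \<forall>x. \<Phi> (2 ^ k * x) \<le> (2 * L) ^ k * \<Phi> x + C"
proof -
  obtain r :: real where "Limsup at_top (\<lambda>x. ereal (\<Phi> (2 * x) / \<Phi> x)) < ereal r"
    using assms ereal_dense2 unfolding Delta2_def by blast
  then have "eventually (\<lambda>x. ereal (\<Phi> (2 * x) / \<Phi> x) < ereal r) at_top"
    by (rule Limsup_lessD)
  then have ev1: "eventually (\<lambda>x. \<Phi> (2 * x) / \<Phi> x < r) at_top"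
    by simp
  \<comment> \<open>Beyond a positive threshold this makes \<open>\<Phi> x\<close> positive, so the
    denominator of the quotient can be cleared.\<close>
  have ev2: "eventually (\<lambda>x. \<Phi> x / x \<ge> 1) at_top"
    using young unfolding young_function_def filterlim_at_top by blast
  obtain b where b: "\<And>x. x \<ge> b \<Longrightarrow> \<Phi> (2 * x) / \<Phi> x < r \<and> \<Phi> x / x \<ge> 1"
    using eventually_conj[OF ev1 ev2] unfolding eventually_at_top_linorder by blast
  define c where "c = max b 1"
  define L where "L = nat \<lceil>\<bar>r\<bar>\<rceil> + 1"
  have "r \<le> real L"
    unfolding L_def by linarith
  then have L: "L \<ge> 1" "r \<le> 2 * real L"
    by (simp add: L_def, linarith)
  have large: "\<Phi> (2 * x) \<le> (2 * L) * \<Phi> x" if "x \<ge> c" for x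
  proof -
    have "\<Phi> x / x \<ge> 1" "x > 0" "\<Phi> (2 * x) / \<Phi> x < r"
      using b[of x] that by (auto simp: c_def)
    then have "\<Phi> x > 0" by (auto simp: field_simps)
    then have "\<Phi> (2 * x) \<le> r * \<Phi> x"
      using \<open>\<Phi> (2 * x) / \<Phi> x < r\<close> by (simp add: field_simps)
    also have "\<dots> \<le> (2 * L) * \<Phi> x"
      using L \<open>\<Phi> x > 0\<close> by (intro mult_right_mono) auto
    finally show ?thesis .
  qed
  have one: "\<Phi> (2 * x) \<le> (2 * L) * \<Phi> x + \<Phi> (2 * c)" for x
  proof (cases "\<bar>x\<bar> \<ge> c")
    case True
    then show ?thesis
      using large[of "\<bar>x\<bar>"] \<Phi>.nonneg[of "2 * c"] \<Phi>.abs[of "2 * x"] by (simp add: \<Phi>.abs abs_mult)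
  next
    case False
    then have "\<Phi> (2 * x) \<le> \<Phi> (2 * c)"
      by (intro \<Phi>.mono) auto
    then show ?thesis
      using \<Phi>.nonneg[of x] by (simp add: add_increasing)
  qed
  have "\<exists>C\<ge>0. \<forall>x. \<Phi> (2 ^ k * x) \<le> (2 * L) ^ k * \<Phi> x + C" for k
  proof (induction k)
    case (Suc k)
    then obtain C where C: "C \<ge> 0" "\<And>x. \<Phi> (2 ^ k * x) \<le> (2 * L) ^ k * \<Phi> x + C"
      by blast
    show ?case
    proof (intro exI[of _ "2 * L * C + \<Phi> (2 * c)"] conjI allI)
      show "0 \<le> 2 * L * C + \<Phi> (2 * c)" using C \<Phi>.nonneg by simp
      fix x
      have "\<Phi> (2 ^ Suc k * x) \<le> (2 * L) * \<Phi> (2 ^ k * x) + \<Phi> (2 * c)"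
        using one[of "2 ^ k * x"] by (simp add: mult.assoc)
      also have "\<dots> \<le> (2 * L) * ((2 * L) ^ k * \<Phi> x + C) + \<Phi> (2 * c)"
        using mult_left_mono[OF C(2)[of x], of "2 * L"] by simp
      finally show "\<Phi> (2 ^ Suc k * x) \<le> (2 * L) ^ Suc k * \<Phi> x + (2 * L * C + \<Phi> (2 * c))"
        by (simp add: algebra_simps)
    qed
  qed (auto intro: exI[of _ 0])
  with L show ?thesis using that by blast
qed

text \<open>The dual form of iterated doubling: Fenchel-Young at \<open>2 ^ k * x\<close> and
  \<open>y\<close>, combined with the bound on \<open>\<Phi> (2 ^ k * x)\<close>, estimates every
  term of the supremum that defines the conjugate at \<open>y / N\<close>.\<close>

lemma young_conjugate_growth:
  assumes "Delta2 \<Phi>" and e: "\<epsilon> > 0"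
  obtains N :: nat and C where "N > 0" "C \<ge> 0"
    "\<And>y. N * young_conjugate \<Phi> (y / N) \<le> \<epsilon> * young_conjugate \<Phi> y + C"
proof -
  obtain L :: nat where L: "L \<ge> 1" "\<And>k. \<exists>C\<ge>0. \<forall>x. \<Phi> (2 ^ k * x) \<le> (2 * L) ^ k * \<Phi> x + C"
    using Delta2_power[OF assms(1)] by blast
  obtain k where k: "(1/2) ^ k < \<epsilon>"
    using real_arch_pow_inv[OF e, of "1/2"] by auto
  obtain C where C: "C \<ge> 0" "\<And>x. \<Phi> (2 ^ k * x) \<le> (2 * L) ^ k * \<Phi> x + C"
    using L(2) by blast
  \<comment> \<open>With this choice \<open>(2 * L) ^ k = 2 ^ k * N\<close>, so after multiplication
    by \<open>N\<close> the factor \<open>(1/2) ^ k < \<epsilon>\<close> remains.\<close>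
  define N where "N = L ^ k"
  have N: "N > 0" using L(1) by (simp add: N_def)
  have "N * young_conjugate \<Phi> (y / N) \<le> \<epsilon> * young_conjugate \<Phi> y + C" for y
  proof -
    have "young_conjugate \<Phi> (y / N) \<le> (young_conjugate \<Phi> y + C) / (2 ^ k * N)"
    proof (rule young_conjugate_le)
      fix x
      have "(2 ^ k * N) * (x * (y / N) - \<Phi> x) = (2 ^ k * x) * y - (2 * L) ^ k * \<Phi> x"
        using N L(1) by (simp add: N_def field_simps)
      also have "\<dots> \<le> (2 ^ k * x) * y - \<Phi> (2 ^ k * x) + C"
        using C(2)[of x] by simp
      also have "\<dots> \<le> young_conjugate \<Phi> y + C"
        using fenchel_young by simp
      finally show "x * (y / N) - \<Phi> x \<le> (young_conjugate \<Phi> y + C) / (2 ^ k * N)"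
        using N by (simp add: pos_le_divide_eq mult.commute)
    qed
    then have "N * young_conjugate \<Phi> (y / N) \<le> (1/2) ^ k * (young_conjugate \<Phi> y + C)"
      using N by (simp add: field_simps)
    also have "\<dots> \<le> (1/2) ^ k * young_conjugate \<Phi> y + C"
      using C(1) mult_left_le_one_le[of C "(1/2) ^ k"] by (simp add: distrib_left power_le_one)
    also have "\<dots> \<le> \<epsilon> * young_conjugate \<Phi> y + C"
      using k by (intro add_right_mono mult_right_mono) (auto intro: \<Psi>.nonneg)
    finally show ?thesis .
  qed
  with N C(1) show ?thesis using that by blast
qed

end

section \<open>Almost surely convergent forward convex combinations\<close>

text \<open>The derivative of \<open>x \<mapsto> sqrt (1 + x\<^sup>2)\<close>.\<close>
definition bounded_slope :: "real \<Rightarrow> real" where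
  "bounded_slope x = x / sqrt (1 + x\<^sup>2)"

text \<open>The vectors (1, x) / a and (1, y) / b are unit vectors with inner product
  \<open>s\<close>, so their squared distance is 2 (1 - s); the slopes are their second coordinates.
  The error of the tangent at \<open>x\<close> is exactly \<open>b * (1 - s)\<close>, and b \<ge>
  1.\<close>

lemma sqrt_one_plus_square_gradient:
  "sqrt (1 + x\<^sup>2) + bounded_slope x * (y - x) + (bounded_slope y - bounded_slope x)\<^sup>2 / 2
     \<le> sqrt (1 + y\<^sup>2)"
proof -
  define a where "a = sqrt (1 + x\<^sup>2)"
  define b where "b = sqrt (1 + y\<^sup>2)"
  have a: "a > 0" "a\<^sup>2 = 1 + x\<^sup>2" and b: "b \<ge> 1" "b\<^sup>2 = 1 + y\<^sup>2"
    unfolding a_def b_def by (auto simp: add_pos_nonneg)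
  define s where "s = (1 + x * y) / (a * b)"
  have s2: "(1 / a - 1 / b)\<^sup>2 + (x / a - y / b)\<^sup>2 = 2 * (1 - s)"
  proof -
    have "(1 / a - 1 / b)\<^sup>2 + (x / a - y / b)\<^sup>2 = (1 + x\<^sup>2) / a\<^sup>2 + (1 + y\<^sup>2) / b\<^sup>2 - 2 * s"
      using a(1) b(1) by (simp add: s_def power2_diff power_divide add_divide_distrib algebra_simps)
    also have "\<dots> = 2 * (1 - s)"
      using a b by (simp flip: a(2) b(2))
    finally show ?thesis .
  qed
  have "(y / b - x / a)\<^sup>2 / 2 \<le> ((1 / a - 1 / b)\<^sup>2 + (x / a - y / b)\<^sup>2) / 2"
    by (simp add: power2_commute)
  also have "\<dots> = 1 - s" using s2 by simp
  also have "\<dots> \<le> b * (1 - s)"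
  proof -
    have "0 \<le> 2 * (1 - s)" unfolding s2[symmetric] by simp
    then show ?thesis using b(1) mult_right_mono[of 1 b "1 - s"] by simp
  qed
  also have "\<dots> = b - (a + (x / a) * (y - x))"
  proof -
    have "a + (x / a) * (y - x) = (a\<^sup>2 + x * y - x\<^sup>2) / a"
      using a(1) by (simp add: field_simps power2_eq_square)
    also have "\<dots> = b * s"
      using a b by (simp add: s_def)
    finally show ?thesis by (simp add: algebra_simps)
  qed
  finally show ?thesis
    unfolding bounded_slope_def a_def[symmetric] b_def[symmetric] by simp
qed

text \<open>The gradient inequality at the midpoint is applied to both ends, and the linear terms
  cancel. This is quantitative strict convexity: a small midpoint defect forces the slopes to be
  close.\<close>

lemma sqrt_one_plus_square_midpoint:
  "(bounded_slope x - bounded_slope y)\<^sup>2 / 8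
     \<le> (sqrt (1 + x\<^sup>2) + sqrt (1 + y\<^sup>2)) / 2 - sqrt (1 + ((x + y) / 2)\<^sup>2)"
proof -
  define m where "m = (x + y) / 2"
  define u where "u = bounded_slope m * (x - m)"
  define v where "v = bounded_slope m * (y - m)"
  define p where "p = bounded_slope x - bounded_slope m"
  define q where "q = bounded_slope y - bounded_slope m"
  have "sqrt (1 + m\<^sup>2) + u + p\<^sup>2 / 2 \<le> sqrt (1 + x\<^sup>2)"
    and "sqrt (1 + m\<^sup>2) + v + q\<^sup>2 / 2 \<le> sqrt (1 + y\<^sup>2)"
    unfolding u_def v_def p_def q_def by (rule sqrt_one_plus_square_gradient)+
  moreover have "u + v = 0"
    unfolding u_def v_def m_def by (simp flip: distrib_left)
  ultimately have "(p\<^sup>2 + q\<^sup>2) / 4 \<le> (sqrt (1 + x\<^sup>2) + sqrt (1 + y\<^sup>2)) / 2 - sqrt (1 + m\<^sup>2)"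
    by argo
  moreover have "(p - q)\<^sup>2 / 8 \<le> (p\<^sup>2 + q\<^sup>2) / 4"
    using zero_le_power2[of "p + q"] by (simp add: power2_eq_square algebra_simps)
  moreover have "bounded_slope x - bounded_slope y = p - q"
    by (simp add: p_def q_def)
  ultimately show ?thesis unfolding m_def by (simp only: order_trans)
qed

text \<open>An explicit left inverse of the slope, which carries limits of slopes back to limits of
  values.\<close>

lemma bounded_slope_inverse: "bounded_slope x / sqrt (1 - (bounded_slope x)\<^sup>2) = x"
proof -
  have pos: "1 + x\<^sup>2 > 0" by (simp add: add_pos_nonneg)
  have "1 - (bounded_slope x)\<^sup>2 = 1 / (1 + x\<^sup>2)"
    using pos by (simp add: bounded_slope_def power_divide field_simps)
  then show ?thesis
    using pos by (simp add: bounded_slope_def real_sqrt_divide)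
qed

lemma abs_bounded_slope_less: "\<bar>bounded_slope x\<bar> < 1"
proof -
  have "\<bar>x\<bar> < sqrt (1 + x\<^sup>2)"
    by (rule real_less_rsqrt) simp
  moreover have "sqrt (1 + x\<^sup>2) > 0" by (simp add: add_pos_nonneg)
  ultimately show ?thesis by (simp add: bounded_slope_def abs_divide)
qed

text \<open>The slopes tend to some \<open>H\<close> in [-1, 1]. If
  \<open>\<bar>H\<bar> = 1\<close>, the absolute values would tend to infinity, against the finite
  lower limit; otherwise the inverse of the slope is continuous at \<open>H\<close>.\<close>

lemma convergent_of_bounded_slope:
  assumes conv: "convergent (\<lambda>k. bounded_slope (x k))"
    and liminf: "liminf (\<lambda>k. ennreal \<bar>x k\<bar>) < \<infinity>"
  shows "convergent x"
proof -
  let ?g = "\<lambda>z::real. z / sqrt (1 - z\<^sup>2)"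
  obtain H where H: "(\<lambda>k. bounded_slope (x k)) \<longlonglongrightarrow> H"
    using conv by (auto simp: convergent_def)
  have x: "x = (\<lambda>k. ?g (bounded_slope (x k)))"
    by (simp add: bounded_slope_inverse)
  have "(\<lambda>k. \<bar>bounded_slope (x k)\<bar>) \<longlonglongrightarrow> \<bar>H\<bar>"
    using H by (rule tendsto_rabs)
  then have "\<bar>H\<bar> \<le> 1"
    by (rule LIMSEQ_le_const2) (auto intro: less_imp_le abs_bounded_slope_less)
  moreover have "\<bar>H\<bar> \<noteq> 1"
  proof
    assume H1: "\<bar>H\<bar> = 1"
    have "eventually (\<lambda>k. \<bar>x k\<bar> \<ge> c) sequentially" for c
    proof -
      \<comment> \<open>\<open>d\<close> is the absolute slope at \<open>c\<close>. As t / (1 + t)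
        increases for t \<ge> 0, an absolute slope above \<open>d\<close> forces an absolute value
        above \<open>\<bar>c\<bar>\<close>.\<close>
      define d where "d = \<bar>c\<bar> / sqrt (1 + c\<^sup>2)"
      have "d < 1"
        using abs_bounded_slope_less[of c] by (simp add: d_def bounded_slope_def abs_divide)
      then have "eventually (\<lambda>k. \<bar>bounded_slope (x k)\<bar> > d) sequentially"
        using \<open>(\<lambda>k. \<bar>bounded_slope (x k)\<bar>) \<longlonglongrightarrow> \<bar>H\<bar>\<close> H1 by (intro order_tendstoD) auto
      then show ?thesis
      proof eventually_elim
        case (elim k)
        show ?case
        proof (rule ccontr)
          assume "\<not> c \<le> \<bar>x k\<bar>"
          then have *: "(x k)\<^sup>2 \<le> c\<^sup>2"
            by (simp add: abs_le_square_iff[symmetric])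
          have "\<bar>bounded_slope (x k)\<bar>\<^sup>2 = (x k)\<^sup>2 / (1 + (x k)\<^sup>2)"
            by (simp add: bounded_slope_def power_divide add_pos_nonneg)
          also have "\<dots> \<le> c\<^sup>2 / (1 + c\<^sup>2)"
            using * by (subst frac_le_eq) (auto simp: add_pos_nonneg add_nonneg_eq_0_iff field_simps divide_le_0_iff)
          also have "\<dots> = d\<^sup>2"
            by (simp add: d_def power_divide add_pos_nonneg)
          finally have "\<bar>bounded_slope (x k)\<bar> \<le> d"
            by (rule power2_le_imp_le) (simp add: d_def)
          with elim show False by simp
        qed
      qed
    qed
    then have "ennreal c \<le> liminf (\<lambda>k. ennreal \<bar>x k\<bar>)" for c
      by (intro Liminf_bounded) (auto elim!: eventually_mono intro: ennreal_leI)
    moreover obtain c where "liminf (\<lambda>k. ennreal \<bar>x k\<bar>) = ennreal c" "0 \<le> c"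
      using liminf by (cases "liminf (\<lambda>k. ennreal \<bar>x k\<bar>)") auto
    ultimately have "ennreal (c + 1) \<le> ennreal c" by metis
    then show False using \<open>0 \<le> c\<close> by (simp add: ennreal_le_iff)
  qed
  ultimately have "\<bar>H\<bar> < 1" by simp
  then have "H\<^sup>2 < 1"
    by (simp add: abs_square_less_1)
  then have "(\<lambda>k. ?g (bounded_slope (x k))) \<longlonglongrightarrow> ?g H"
    by (intro tendsto_intros H) auto
  then show ?thesis
    unfolding convergent_def by (subst x) blast
qed

text \<open>The sets shrink, so the infima \<open>J n\<close> increase to their supremum
  \<open>S\<close>. Two near minimisers in \<open>C n\<close> have their midpoint in
  \<open>C n\<close>, so the midpoint inequality makes their slopes close in L2. Summable errors
  give almost sure convergence of the slopes.\<close>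

lemma (in prob_space) convergent_forward_selection:
  fixes C :: "nat \<Rightarrow> ('a \<Rightarrow> real) set"
  assumes anti: "\<And>m n. m \<le> n \<Longrightarrow> C n \<subseteq> C m"
    and ne: "\<And>n. C n \<noteq> {}"
    and mid: "\<And>n g h. g \<in> C n \<Longrightarrow> h \<in> C n \<Longrightarrow> (\<lambda>\<omega>. (g \<omega> + h \<omega>) / 2) \<in> C n"
    and int: "\<And>g. g \<in> C 0 \<Longrightarrow> integrable M g"
    and bound: "\<And>g. g \<in> C 0 \<Longrightarrow> (\<integral>\<omega>. \<bar>g \<omega>\<bar> \<partial>M) \<le> B"
  obtains \<eta> \<zeta> where "\<And>n. \<eta> n \<in> C n" "\<zeta> \<in> borel_measurable M"
    "AE \<omega> in M. (\<lambda>n. \<eta> n \<omega>) \<longlonglongrightarrow> \<zeta> \<omega>"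
proof -
  have C0: "g \<in> C n \<Longrightarrow> g \<in> C 0" for g n
    using anti[of 0 n] by auto
  have meas: "g \<in> borel_measurable M" if "g \<in> C n" for g n
    using int[OF C0[OF that]] by simp
  define I where "I g = (\<integral>\<omega>. sqrt (1 + (g \<omega>)\<^sup>2) \<partial>M)" for g :: "'a \<Rightarrow> real"
  have le: "sqrt (1 + x\<^sup>2) \<le> 1 + \<bar>x\<bar>" for x :: real
    by (rule real_le_lsqrt) (auto simp: power2_eq_square algebra_simps)
  have intf: "integrable M (\<lambda>\<omega>. sqrt (1 + (g \<omega>)\<^sup>2))" if "g \<in> C 0" for g
  proof (rule Bochner_Integration.integrable_bound)
    show "integrable M (\<lambda>\<omega>. 1 + \<bar>g \<omega>\<bar>)" using int[OF that] by simp
    show "(\<lambda>\<omega>. sqrt (1 + (g \<omega>)\<^sup>2)) \<in> borel_measurable M"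
      using meas[OF that] by measurable
  qed (use le in \<open>auto intro!: AE_I2\<close>)
  have I_le: "I g \<le> 1 + B" if "g \<in> C 0" for g
  proof -
    have "I g \<le> (\<integral>\<omega>. 1 + \<bar>g \<omega>\<bar> \<partial>M)"
      unfolding I_def using int[OF that] intf[OF that] le by (intro integral_mono) auto
    also have "\<dots> \<le> 1 + B"
      using int[OF that] bound[OF that] by (simp add: prob_space)
    finally show ?thesis .
  qed
  have I0: "0 \<le> I g" for g
    unfolding I_def by (rule integral_nonneg_AE) simp
  have gap: "(\<integral>\<omega>. (bounded_slope (g \<omega>) - bounded_slope (h \<omega>))\<^sup>2 \<partial>M) / 8
      \<le> (I g + I h) / 2 - I (\<lambda>\<omega>. (g \<omega> + h \<omega>) / 2)"
    and intgap: "integrable M (\<lambda>\<omega>. (bounded_slope (g \<omega>) - bounded_slope (h \<omega>))\<^sup>2)"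
    if g: "g \<in> C 0" and h: "h \<in> C 0" for g h
  proof -
    note m = mid[OF g h]
    let ?r = "\<lambda>\<omega>. (sqrt (1 + (g \<omega>)\<^sup>2) + sqrt (1 + (h \<omega>)\<^sup>2)) / 2 - sqrt (1 + ((g \<omega> + h \<omega>) / 2)\<^sup>2)"
    have r: "integrable M ?r"
      using intf[OF g] intf[OF h] intf[OF m] by simp
    show int2: "integrable M (\<lambda>\<omega>. (bounded_slope (g \<omega>) - bounded_slope (h \<omega>))\<^sup>2)"
    proof (rule Bochner_Integration.integrable_bound)
      show "integrable M (\<lambda>\<omega>. 8 * ?r \<omega>)" by (intro integrable_mult_right r)
      show "(\<lambda>\<omega>. (bounded_slope (g \<omega>) - bounded_slope (h \<omega>))\<^sup>2) \<in> borel_measurable M"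
        using meas[OF g] meas[OF h] unfolding bounded_slope_def by measurable
      show "AE \<omega> in M. norm ((bounded_slope (g \<omega>) - bounded_slope (h \<omega>))\<^sup>2) \<le> norm (8 * ?r \<omega>)"
      proof (rule AE_I2)
        fix \<omega>
        have "(bounded_slope (g \<omega>) - bounded_slope (h \<omega>))\<^sup>2 \<le> 8 * ?r \<omega>"
          using sqrt_one_plus_square_midpoint[of "g \<omega>" "h \<omega>"] by argo
        then show "norm ((bounded_slope (g \<omega>) - bounded_slope (h \<omega>))\<^sup>2) \<le> norm (8 * ?r \<omega>)"
          unfolding real_norm_def abs_power2 by (rule order_trans[OF _ abs_ge_self])
      qed
    qed
    have "(\<integral>\<omega>. (bounded_slope (g \<omega>) - bounded_slope (h \<omega>))\<^sup>2 / 8 \<partial>M) \<le> (\<integral>\<omega>. ?r \<omega> \<partial>M)"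
      using int2 r by (intro integral_mono sqrt_one_plus_square_midpoint) auto
    also have "(\<integral>\<omega>. ?r \<omega> \<partial>M) = (I g + I h) / 2 - I (\<lambda>\<omega>. (g \<omega> + h \<omega>) / 2)"
      unfolding I_def using intf[OF g] intf[OF h] intf[OF m] by simp
    finally show "(\<integral>\<omega>. (bounded_slope (g \<omega>) - bounded_slope (h \<omega>))\<^sup>2 \<partial>M) / 8
      \<le> (I g + I h) / 2 - I (\<lambda>\<omega>. (g \<omega> + h \<omega>) / 2)" by simp
  qed
  define J where "J n = (INF g\<in>C n. I g)" for n
  have bdd: "bdd_below (I ` A)" for A
    using I0 by (auto intro!: bdd_belowI)
  have J_le: "J n \<le> I g" if "g \<in> C n" for g n
    unfolding J_def using that bdd by (intro cINF_lower)
  have J_mono: "J m \<le> J n" if "m \<le> n" for m n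
    unfolding J_def using ne anti[OF that] bdd by (intro cINF_superset_mono) auto
  have J_bdd: "bdd_above (range J)"
  proof (rule bdd_aboveI)
    fix x assume "x \<in> range J"
    then obtain n where n: "x = J n" by blast
    obtain g where "g \<in> C n" using ne by blast
    then show "x \<le> 1 + B" using J_le[of g n] I_le[OF C0[of g n]] n by simp
  qed
  define S where "S = (SUP n. J n)"
  have J_S: "J n \<le> S" for n
    unfolding S_def using J_bdd by (intro cSUP_upper) auto
  \<comment> \<open>An index in the k-th tail where the infimum is within 4^-k of its supremum; the
    function chosen there will itself be within 4^-k of that infimum.\<close>
  have "\<exists>n\<ge>k. S - (1/4) ^ k \<le> J n" for k :: nat
  proof -
    have "S - (1/4) ^ k < (SUP n. J n)" by (simp add: S_def)
    then obtain n where "S - (1/4) ^ k < J n"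
      using J_bdd by (subst (asm) less_cSUP_iff) auto
    then show ?thesis
      using J_mono[of n "max n k"] by (intro exI[of _ "max n k"]) auto
  qed
  then obtain N where N: "\<And>k. N k \<ge> k" "\<And>k. S - (1/4) ^ k \<le> J (N k)"
    by metis
  have "\<exists>g\<in>C (N k). I g < J (N k) + (1/4) ^ k" for k
  proof -
    have "(INF g\<in>C (N k). I g) < J (N k) + (1/4) ^ k" by (simp add: J_def)
    then show ?thesis
      using bdd ne by (subst (asm) cINF_less_iff) auto
  qed
  then obtain \<eta> where \<eta>: "\<And>k. \<eta> k \<in> C (N k)" "\<And>k. I (\<eta> k) < J (N k) + (1/4) ^ k"
    by metis
  have \<eta>C: "\<eta> k \<in> C k" for k using \<eta>(1) anti[OF N(1)] by auto
  define D where "D k \<omega> = bounded_slope (\<eta> (Suc k) \<omega>) - bounded_slope (\<eta> k \<omega>)" for k \<omega>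
  have D2: "(\<integral>\<omega>. (D k \<omega>)\<^sup>2 \<partial>M) \<le> 16 * (1/4) ^ k" for k
  proof -
    \<comment> \<open>\<open>N\<close> need not be monotone. Both functions lie in
      \<open>C n\<close> for the smaller index, and \<open>J n\<close> is within 4^-k of
      \<open>S\<close> in either case.\<close>
    define n where "n = min (N k) (N (Suc k))"
    have "\<eta> k \<in> C n" "\<eta> (Suc k) \<in> C n"
      using \<eta>(1)[of k] \<eta>(1)[of "Suc k"] anti[of n "N k"] anti[of n "N (Suc k)"] by (auto simp: n_def)
    then have "J n \<le> I (\<lambda>\<omega>. (\<eta> (Suc k) \<omega> + \<eta> k \<omega>) / 2)"
      by (intro J_le mid)
    moreover have "S - (1/4) ^ k \<le> J n"
    proof (cases "N k \<le> N (Suc k)")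
      case False
      have "S - (1/4) ^ k \<le> S - (1/4::real) ^ Suc k" by simp
      also have "\<dots> \<le> J (N (Suc k))" by (rule N(2))
      finally show ?thesis using False by (simp add: n_def)
    qed (use N(2)[of k] in \<open>simp add: n_def\<close>)
    moreover have "I (\<eta> k) \<le> S + (1/4) ^ k" "I (\<eta> (Suc k)) \<le> S + (1/4) ^ k"
      using \<eta>(2)[of k] \<eta>(2)[of "Suc k"] J_S[of "N k"] J_S[of "N (Suc k)"]
        zero_le_power[of "1/4 :: real" k] unfolding power_Suc by linarith+
    \<comment> \<open>The mean of both values is at most S + 4^-k and the midpoint value at least S
      - 4^-k; the factor 8 of the midpoint inequality yields 16.\<close>
    ultimately show ?thesis
      using gap[OF C0[OF \<eta>C] C0[OF \<eta>C], of "Suc k" k] unfolding D_def by argo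
  qed
  have intD2: "integrable M (\<lambda>\<omega>. (D k \<omega>)\<^sup>2)" for k
    unfolding D_def by (rule intgap[OF C0[OF \<eta>C] C0[OF \<eta>C]])
  note [measurable] = meas[OF \<eta>C]
  have D_meas [measurable]: "D k \<in> borel_measurable M" for k
    unfolding D_def bounded_slope_def by measurable
  have "(\<integral>\<^sup>+\<omega>. ennreal \<bar>D k \<omega>\<bar> \<partial>M) \<le> ennreal (9 * (1/2) ^ k)" for k
  proof -
    \<comment> \<open>Arithmetic-geometric mean with weight 2^k, which balances the squared L2 bound
      of order 4^-k and leaves a summable L1 bound of order 2^-k.\<close>
    have "\<bar>D k \<omega>\<bar> \<le> (2 ^ k * (D k \<omega>)\<^sup>2 + (1/2) ^ k) / 2" for \<omega>
    proof -
      have "0 \<le> 2 ^ k * (\<bar>D k \<omega>\<bar> - (1/2) ^ k)\<^sup>2" by simp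
      also have "\<dots> = 2 ^ k * (D k \<omega>)\<^sup>2 + (1/2) ^ k - 2 * \<bar>D k \<omega>\<bar>"
        by (simp add: power2_diff field_simps power2_eq_square)
      finally show ?thesis by simp
    qed
    then have "(\<integral>\<^sup>+\<omega>. ennreal \<bar>D k \<omega>\<bar> \<partial>M) \<le> (\<integral>\<^sup>+\<omega>. ennreal ((2 ^ k * (D k \<omega>)\<^sup>2 + (1/2) ^ k) / 2) \<partial>M)"
      by (intro nn_integral_mono ennreal_leI)
    also have "\<dots> = ennreal (\<integral>\<omega>. (2 ^ k * (D k \<omega>)\<^sup>2 + (1/2) ^ k) / 2 \<partial>M)"
      using intD2 by (intro nn_integral_eq_integral) auto
    also have "(\<integral>\<omega>. (2 ^ k * (D k \<omega>)\<^sup>2 + (1/2) ^ k) / 2 \<partial>M)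
        = (2 ^ k * (\<integral>\<omega>. (D k \<omega>)\<^sup>2 \<partial>M) + (1/2) ^ k) / 2"
      using intD2[of k] by (simp add: prob_space)
    also have "\<dots> \<le> (2 ^ k * (16 * (1/4) ^ k) + (1/2) ^ k) / 2"
      using D2[of k] by simp
    also have "\<dots> = 17/2 * (1/2) ^ k"
    proof -
      have "(2::real) ^ k * (1/4) ^ k = (1/2) ^ k"
        by (simp flip: power_mult_distrib)
      then show ?thesis by (simp add: algebra_simps)
    qed
    also have "\<dots> \<le> 9 * (1/2) ^ k" by simp
    finally show ?thesis by (simp add: ennreal_leI)
  qed
  then have "(\<Sum>k. \<integral>\<^sup>+\<omega>. ennreal \<bar>D k \<omega>\<bar> \<partial>M) \<le> (\<Sum>k. ennreal (9 * (1/2) ^ k))"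
    by (intro suminf_le) auto
  also have "\<dots> < \<infinity>"
    by (subst suminf_ennreal2) (auto intro!: summable_mult summable_geometric)
  also have "(\<Sum>k. \<integral>\<^sup>+\<omega>. ennreal \<bar>D k \<omega>\<bar> \<partial>M) = (\<integral>\<^sup>+\<omega>. (\<Sum>k. ennreal \<bar>D k \<omega>\<bar>) \<partial>M)"
    by (rule nn_integral_suminf[symmetric]) measurable
  finally have "AE \<omega> in M. (\<Sum>k. ennreal \<bar>D k \<omega>\<bar>) \<noteq> \<infinity>"
    by (intro nn_integral_PInf_AE) auto
  \<comment> \<open>Fatou and the L1 bound rule out divergence to infinity, which convergence of the
    slopes alone would allow.\<close>
  moreover have "AE \<omega> in M. liminf (\<lambda>k. ennreal \<bar>\<eta> k \<omega>\<bar>) \<noteq> \<infinity>"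
  proof (intro nn_integral_PInf_AE)
    have "(\<integral>\<^sup>+\<omega>. liminf (\<lambda>k. ennreal \<bar>\<eta> k \<omega>\<bar>) \<partial>M) \<le> liminf (\<lambda>k. \<integral>\<^sup>+\<omega>. ennreal \<bar>\<eta> k \<omega>\<bar> \<partial>M)"
      by (intro nn_integral_liminf) measurable
    also have "\<dots> \<le> liminf (\<lambda>k::nat. ennreal B)"
    proof (intro Liminf_mono always_eventually allI)
      fix k
      have "(\<integral>\<^sup>+\<omega>. ennreal \<bar>\<eta> k \<omega>\<bar> \<partial>M) = ennreal (\<integral>\<omega>. \<bar>\<eta> k \<omega>\<bar> \<partial>M)"
        using int[OF C0[OF \<eta>C]] by (intro nn_integral_eq_integral) auto
      then show "(\<integral>\<^sup>+\<omega>. ennreal \<bar>\<eta> k \<omega>\<bar> \<partial>M) \<le> ennreal B"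
        using bound[OF C0[OF \<eta>C]] by (simp add: ennreal_leI)
    qed
    also have "\<dots> = ennreal B" by (simp add: Liminf_const)
    finally show "(\<integral>\<^sup>+\<omega>. liminf (\<lambda>k. ennreal \<bar>\<eta> k \<omega>\<bar>) \<partial>M) \<noteq> \<infinity>"
      by (auto simp: top_unique)
  qed measurable
  ultimately have conv: "AE \<omega> in M. convergent (\<lambda>k. \<eta> k \<omega>)"
  proof eventually_elim
    case (elim \<omega>)
    have "summable (\<lambda>k. \<bar>D k \<omega>\<bar>)"
      using elim(1) by (intro summable_suminf_not_top) auto
    then have "summable (\<lambda>k. D k \<omega>)"
      by (rule summable_rabs_cancel)
    then have "convergent (\<lambda>n. \<Sum>k<n. D k \<omega>)"
      by (simp add: summable_iff_convergent)
    then have "convergent (\<lambda>n. bounded_slope (\<eta> n \<omega>) - bounded_slope (\<eta> 0 \<omega>))"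
      unfolding D_def sum_lessThan_telescope[of "\<lambda>n. bounded_slope (\<eta> n \<omega>)"] .
    then have "convergent (\<lambda>n. bounded_slope (\<eta> n \<omega>))"
      by (simp add: convergent_diff_const_right_iff)
    moreover have "liminf (\<lambda>k. ennreal \<bar>\<eta> k \<omega>\<bar>) < \<infinity>"
      using elim(2) by (simp add: less_top[symmetric])
    ultimately show ?case
      by (rule convergent_of_bounded_slope)
  qed
  show ?thesis
  proof
    \<comment> \<open>On the null set where the sequence diverges, \<open>lim\<close> has an
      unspecified value, harmless for an almost sure statement.\<close>
    show "(\<lambda>\<omega>. lim (\<lambda>k. \<eta> k \<omega>)) \<in> borel_measurable M"
      by (intro borel_measurable_lim_metric) measurable
    show "AE \<omega> in M. (\<lambda>k. \<eta> k \<omega>) \<longlonglongrightarrow> lim (\<lambda>k. \<eta> k \<omega>)"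
      using conv by eventually_elim (simp add: convergent_LIMSEQ_iff)
  qed (rule \<eta>C)
qed

section \<open>Order bounded averages\<close>

locale even_convex_prob = prob_space M + even_convex \<psi> for M :: "'a measure" and \<psi>
begin

text \<open>Integrability is stated explicitly because the Bochner integral of a nonintegrable
  function is 0 by convention.\<close>

definition unit_ball :: "('a \<Rightarrow> real) set" where
  "unit_ball = {g \<in> borel_measurable M. integrable M (\<lambda>\<omega>. \<psi> (g \<omega>)) \<and> (\<integral>\<omega>. \<psi> (g \<omega>) \<partial>M) \<le> 1}"

lemma unit_ball_nn_integral:
  "unit_ball = {g \<in> borel_measurable M. (\<integral>\<^sup>+\<omega>. ennreal (\<psi> (g \<omega>)) \<partial>M) \<le> 1}"
proof (intro set_eqI iffI)
  fix g assume "g \<in> unit_ball"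
  then show "g \<in> {g \<in> borel_measurable M. (\<integral>\<^sup>+\<omega>. ennreal (\<psi> (g \<omega>)) \<partial>M) \<le> 1}"
    by (auto simp: unit_ball_def nn_integral_eq_integral nonneg)
next
  fix g assume g: "g \<in> {g \<in> borel_measurable M. (\<integral>\<^sup>+\<omega>. ennreal (\<psi> (g \<omega>)) \<partial>M) \<le> 1}"
  then have [measurable]: "g \<in> borel_measurable M" by simp
  have int: "integrable M (\<lambda>\<omega>. \<psi> (g \<omega>))"
    using g by (intro integrableI_nonneg) (auto simp: nonneg intro: le_less_trans)
  then have "ennreal (\<integral>\<omega>. \<psi> (g \<omega>) \<partial>M) \<le> ennreal 1"
    using g by (simp add: nn_integral_eq_integral nonneg)
  then have "(\<integral>\<omega>. \<psi> (g \<omega>) \<partial>M) \<le> 1"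
    by (subst (asm) ennreal_le_iff) auto
  then show "g \<in> unit_ball" using int by (simp add: unit_ball_def)
qed

text \<open>Jensen pointwise, then linearity of the integral.\<close>

lemma fun_conv_unit_ball:
  assumes "S \<subseteq> unit_ball"
  shows "fun_conv S \<subseteq> unit_ball"
proof
  fix g assume "g \<in> fun_conv S"
  then obtain F u where F: "finite F" "F \<subseteq> S" "\<forall>f\<in>F. 0 \<le> u f" "sum u F = 1"
    "g = (\<lambda>\<omega>. \<Sum>f\<in>F. u f * f \<omega>)"
    unfolding fun_conv_def by blast
  have FB: "f \<in> borel_measurable M" "integrable M (\<lambda>\<omega>. \<psi> (f \<omega>))" "(\<integral>\<omega>. \<psi> (f \<omega>) \<partial>M) \<le> 1"
    if "f \<in> F" for f
    using that F(2) assms by (auto simp: unit_ball_def)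
  have meas [measurable]: "g \<in> borel_measurable M"
    unfolding F(5) using FB(1) by (intro borel_measurable_sum borel_measurable_times) auto
  have "F \<noteq> {}" using F(4) by auto
  then have le: "\<psi> (g \<omega>) \<le> (\<Sum>f\<in>F. u f * \<psi> (f \<omega>))" for \<omega>
    unfolding F(5) using convex_on_sum[OF F(1) _ convex, of u "\<lambda>f. f \<omega>"] F(3,4) by auto
  have int: "integrable M (\<lambda>\<omega>. \<Sum>f\<in>F. u f * \<psi> (f \<omega>))"
    using FB(2) by (intro Bochner_Integration.integrable_sum integrable_mult_right) auto
  have intg: "integrable M (\<lambda>\<omega>. \<psi> (g \<omega>))"
    by (rule Bochner_Integration.integrable_bound[OF int])
      (auto intro!: AE_I2 simp: nonneg intro: order_trans[OF le] abs_ge_self)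
  have "(\<integral>\<omega>. \<psi> (g \<omega>) \<partial>M) \<le> (\<integral>\<omega>. (\<Sum>f\<in>F. u f * \<psi> (f \<omega>)) \<partial>M)"
    using intg int le by (intro integral_mono)
  also have "\<dots> = (\<Sum>f\<in>F. u f * (\<integral>\<omega>. \<psi> (f \<omega>) \<partial>M))"
    using FB(2) by (subst Bochner_Integration.integral_sum) (auto intro!: integrable_mult_right)
  also have "\<dots> \<le> (\<Sum>f\<in>F. u f * 1)"
    using FB(3) F(3) by (intro sum_mono mult_left_mono) auto
  also have "\<dots> = 1" using F(4) by simp
  finally show "g \<in> unit_ball" using intg by (simp add: unit_ball_def)
qed

text \<open>Continuity of \<psi> and Fatou's lemma.\<close>

lemma unit_ball_AE_closed:
  assumes g: "\<And>n. g n \<in> unit_ball" and h: "h \<in> borel_measurable M"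
    and lim: "AE \<omega> in M. (\<lambda>n. g n \<omega>) \<longlonglongrightarrow> h \<omega>"
  shows "h \<in> unit_ball"
proof -
  have [measurable]: "g n \<in> borel_measurable M" for n
    using g by (simp add: unit_ball_def)
  have "(\<integral>\<^sup>+\<omega>. ennreal (\<psi> (h \<omega>)) \<partial>M) = (\<integral>\<^sup>+\<omega>. liminf (\<lambda>n. ennreal (\<psi> (g n \<omega>))) \<partial>M)"
  proof (rule nn_integral_cong_AE)
    show "AE \<omega> in M. ennreal (\<psi> (h \<omega>)) = liminf (\<lambda>n. ennreal (\<psi> (g n \<omega>)))"
      using lim
    proof eventually_elim
      case (elim \<omega>)
      have "(\<lambda>n. \<psi> (g n \<omega>)) \<longlonglongrightarrow> \<psi> (h \<omega>)"
        by (rule continuous_on_tendsto_compose[OF continuous[of UNIV] elim]) auto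
      then have "(\<lambda>n. ennreal (\<psi> (g n \<omega>))) \<longlonglongrightarrow> ennreal (\<psi> (h \<omega>))"
        by (rule tendsto_ennrealI)
      then show ?case by (simp add: lim_imp_Liminf)
    qed
  qed
  also have "\<dots> \<le> liminf (\<lambda>n. \<integral>\<^sup>+\<omega>. ennreal (\<psi> (g n \<omega>)) \<partial>M)"
    by (intro nn_integral_liminf) measurable
  also have "\<dots> \<le> liminf (\<lambda>n::nat. 1)"
    using g by (intro Liminf_mono always_eventually) (auto simp: unit_ball_nn_integral)
  finally show ?thesis using h by (simp add: unit_ball_nn_integral Liminf_const)
qed

section \<open>Sparse averages of a null sequence\<close>

context
  fixes z :: "nat \<Rightarrow> 'a \<Rightarrow> real"
  assumes z_ball: "\<And>n. z n \<in> unit_ball"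
    and z_null: "AE \<omega> in M. (\<lambda>n. z n \<omega>) \<longlonglongrightarrow> 0"
begin

lemma z_measurable: "z n \<in> borel_measurable M"
  using z_ball by (simp add: unit_ball_def)

lemma large_part_integrable:
  assumes "integrable M g"
  shows "integrable M (\<lambda>\<omega>. of_bool (\<bar>z n \<omega>\<bar> > 1) * g \<omega> :: real)"
proof -
  note [measurable] = z_measurable
  show ?thesis
    by (rule Bochner_Integration.integrable_bound[OF assms]) (use assms in auto)
qed

text \<open>Dominated convergence: at almost every point the indicator is eventually 0, and
  \<open>\<bar>g\<bar>\<close> is a majorant.\<close>

lemma large_part_tendsto:
  fixes g :: "'a \<Rightarrow> real"
  assumes g: "integrable M g"
  shows "(\<lambda>n. \<integral>\<omega>. of_bool (\<bar>z n \<omega>\<bar> > 1) * g \<omega> \<partial>M) \<longlonglongrightarrow> 0"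
proof -
  note [measurable] = z_measurable
  have "(\<lambda>n. \<integral>\<omega>. of_bool (\<bar>z n \<omega>\<bar> > 1) * g \<omega> \<partial>M) \<longlonglongrightarrow> (\<integral>\<omega>. 0 \<partial>M)"
  proof (rule integral_dominated_convergence)
    show "integrable M (\<lambda>\<omega>. \<bar>g \<omega>\<bar>)" using g by simp
    show "AE \<omega> in M. (\<lambda>n. of_bool (\<bar>z n \<omega>\<bar> > 1) * g \<omega>) \<longlonglongrightarrow> 0"
      using z_null
    proof eventually_elim
      case (elim \<omega>)
      have "(\<lambda>n. \<bar>z n \<omega>\<bar>) \<longlonglongrightarrow> 0" using elim by (rule tendsto_rabs_zero)
      then have "eventually (\<lambda>n. \<bar>z n \<omega>\<bar> < 1) sequentially"
        by (rule order_tendstoD) simp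
      then have "eventually (\<lambda>n. of_bool (\<bar>z n \<omega>\<bar> > 1) * g \<omega> = 0) sequentially"
        by eventually_elim simp
      then show ?case by (rule tendsto_eventually)
    qed
  qed (use g in auto)
  then show ?thesis by simp
qed

text \<open>Indices are chosen one after another. At each choice the earlier \<psi>(z) are finitely
  many fixed integrable functions, so a late index makes all required integrals small. Only pairs i
  < j are controlled, as in the double sum of \<open>average_split\<close>.\<close>

lemma sparse_selection:
  fixes N :: nat
  assumes \<delta>: "\<delta> > 0"
  shows "\<exists>f. (\<forall>i. f i \<ge> m) \<and> (\<forall>j<N. (\<integral>\<omega>. of_bool (\<bar>z (f j) \<omega>\<bar> > 1) \<partial>M) \<le> \<delta> \<and>
     (\<forall>i<j. (\<integral>\<omega>. of_bool (\<bar>z (f j) \<omega>\<bar> > 1) * \<psi> (z (f i) \<omega>) \<partial>M) \<le> \<delta>))"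
proof (induction N)
  case 0
  show ?case by (intro exI[of _ "\<lambda>_. m"]) auto
next
  case (Suc N)
  then obtain f where f: "\<And>i. f i \<ge> m"
    "\<And>j. j < N \<Longrightarrow> (\<integral>\<omega>. of_bool (\<bar>z (f j) \<omega>\<bar> > 1) \<partial>M) \<le> \<delta>"
    "\<And>i j. i < j \<Longrightarrow> j < N \<Longrightarrow> (\<integral>\<omega>. of_bool (\<bar>z (f j) \<omega>\<bar> > 1) * \<psi> (z (f i) \<omega>) \<partial>M) \<le> \<delta>"
    by blast
  have small: "eventually (\<lambda>n. (\<integral>\<omega>. of_bool (\<bar>z n \<omega>\<bar> > 1) * g \<omega> \<partial>M) < \<delta>) sequentially"
    if "integrable M g" for g :: "'a \<Rightarrow> real"
    using large_part_tendsto[OF that] \<delta> by (rule order_tendstoD)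
  \<comment> \<open>The factor 1 presents the probability as the case of a constant
    \<open>g\<close>.\<close>
  have "eventually (\<lambda>n. n \<ge> m \<and> (\<integral>\<omega>. of_bool (\<bar>z n \<omega>\<bar> > 1) * 1 \<partial>M) < \<delta> \<and>
      (\<forall>i\<in>{..<N}. (\<integral>\<omega>. of_bool (\<bar>z n \<omega>\<bar> > 1) * \<psi> (z (f i) \<omega>) \<partial>M) < \<delta>)) sequentially"
    using z_ball by (intro eventually_conj eventually_ball_finite ballI small eventually_ge_at_top)
      (auto simp: unit_ball_def)
  then obtain n where n: "n \<ge> m" "(\<integral>\<omega>. of_bool (\<bar>z n \<omega>\<bar> > 1) \<partial>M) < \<delta>"
      "\<And>i. i < N \<Longrightarrow> (\<integral>\<omega>. of_bool (\<bar>z n \<omega>\<bar> > 1) * \<psi> (z (f i) \<omega>) \<partial>M) < \<delta>"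
    unfolding eventually_sequentially by auto
  show ?case
    using f n by (intro exI[of _ "f(N := n)"]) (auto simp: less_Suc_eq intro: less_imp_le)
qed

text \<open>\<open>average_split\<close> is integrated. The additive constant of the growth
  condition is charged only where a term exceeds 1, an event of probability at most \<delta>; the
  \<epsilon> / 2 parts, each divided by \<open>N\<close>, add up to \<epsilon> / 2.\<close>

lemma small_excess_average:
  assumes growth: "\<And>\<epsilon>. \<epsilon> > 0 \<Longrightarrow> \<exists>N>0. \<exists>C\<ge>0. \<forall>y. real N * \<psi> (y / N) \<le> \<epsilon> * \<psi> y + C"
    and \<epsilon>: "\<epsilon> > 0"
  shows "\<exists>N::nat. N > 0 \<and> (\<exists>f::nat \<Rightarrow> nat. (\<forall>i. f i \<ge> m) \<and>
    (\<integral>\<^sup>+\<omega>. ennreal (\<psi> ((\<Sum>i<N. \<bar>z (f i) \<omega>\<bar>) / N / 3) - \<psi> 1) \<partial>M) \<le> ennreal \<epsilon>)"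
proof -
  note [measurable] = z_measurable
  obtain N :: nat and C where N: "N > 0" and C: "C \<ge> 0"
    and NC: "\<And>y. N * \<psi> (y / N) \<le> \<epsilon> / 2 * \<psi> y + C"
    using growth[of "\<epsilon> / 2"] \<epsilon> by auto
  \<comment> \<open>Chosen so that the constants \<open>C * \<delta>\<close> and at most
    \<open>N * N\<close> interaction terms of size \<delta> together cost \<epsilon> / 2.\<close>
  define \<delta> where "\<delta> = \<epsilon> / (2 * (C + N * N))"
  have "C + N * N > 0" using N C by (simp add: add_nonneg_pos)
  then have "(C + N * N) * \<delta> = \<epsilon> / 2" "\<delta> > 0"
    using \<epsilon> by (simp_all add: \<delta>_def del: distrib_left_numeral)
  then have \<delta>: "\<delta> > 0" "C * \<delta> + N * N * \<delta> = \<epsilon> / 2"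
    by (simp_all add: distrib_right)
  obtain f where f: "\<And>i. f i \<ge> m"
    "\<And>j. j < N \<Longrightarrow> (\<integral>\<omega>. of_bool (\<bar>z (f j) \<omega>\<bar> > 1) \<partial>M) \<le> \<delta>"
    "\<And>i j. i < j \<Longrightarrow> j < N \<Longrightarrow> (\<integral>\<omega>. of_bool (\<bar>z (f j) \<omega>\<bar> > 1) * \<psi> (z (f i) \<omega>) \<partial>M) \<le> \<delta>"
    using sparse_selection[OF \<delta>(1), of m N] by blast
  define P where "P i \<omega> = of_bool (\<bar>z (f i) \<omega>\<bar> > 1) * \<psi> (\<bar>z (f i) \<omega>\<bar> / N)" for i \<omega>
  define Q where "Q i j \<omega> = of_bool (\<bar>z (f j) \<omega>\<bar> > 1) * \<psi> \<bar>z (f i) \<omega>\<bar>" for i j \<omega>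
  define R where "R \<omega> = (\<Sum>i<N. P i \<omega>) + (\<Sum>i<N. \<Sum>j\<in>{i<..<N}. Q i j \<omega>)" for \<omega>
  have int\<psi>: "integrable M (\<lambda>\<omega>. \<psi> (z n \<omega>))" and le1: "(\<integral>\<omega>. \<psi> (z n \<omega>) \<partial>M) \<le> 1" for n
    using z_ball[of n] by (auto simp: unit_ball_def)
  have of_bool_int: "integrable M (\<lambda>\<omega>. of_bool (\<bar>z n \<omega>\<bar> > 1) :: real)" for n
    using large_part_integrable[of "\<lambda>_. 1" n] by simp
  have P_le: "P i \<omega> \<le> (\<epsilon> / 2 * \<psi> (z (f i) \<omega>) + C * of_bool (\<bar>z (f i) \<omega>\<bar> > 1)) / N" for i \<omega>
  proof (cases "\<bar>z (f i) \<omega>\<bar> > 1")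
    case True
    have "\<psi> (\<bar>z (f i) \<omega>\<bar> / N) \<le> (\<epsilon> / 2 * \<psi> \<bar>z (f i) \<omega>\<bar> + C) / N"
      using NC[of "\<bar>z (f i) \<omega>\<bar>"] N by (simp add: pos_le_divide_eq mult.commute)
    then show ?thesis using True by (simp add: P_def abs)
  qed (use \<epsilon> nonneg in \<open>simp add: P_def\<close>)
  have P0: "0 \<le> P i \<omega>" for i \<omega> by (simp add: P_def nonneg)
  have Q0: "0 \<le> Q i j \<omega>" for i j \<omega> by (simp add: Q_def nonneg)
  have bound_int: "integrable M (\<lambda>\<omega>. (\<epsilon> / 2 * \<psi> (z (f i) \<omega>) + C * of_bool (\<bar>z (f i) \<omega>\<bar> > 1)) / N)" for i
    using int\<psi> of_bool_int by simp
  have P_int: "integrable M (P i)" for i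
  proof (rule Bochner_Integration.integrable_bound[OF bound_int])
    show "P i \<in> borel_measurable M" unfolding P_def by measurable
    show "AE \<omega> in M. norm (P i \<omega>)
        \<le> norm ((\<epsilon> / 2 * \<psi> (z (f i) \<omega>) + C * of_bool (\<bar>z (f i) \<omega>\<bar> > 1)) / N)"
      using P0 order_trans[OF P_le abs_ge_self] by (intro AE_I2) (simp only: real_norm_def abs_of_nonneg)
  qed
  have P_integral: "(\<integral>\<omega>. P i \<omega> \<partial>M) \<le> (\<epsilon> / 2 + C * \<delta>) / N" if "i < N" for i
  proof -
    have "(\<integral>\<omega>. P i \<omega> \<partial>M) \<le> (\<integral>\<omega>. (\<epsilon> / 2 * \<psi> (z (f i) \<omega>) + C * of_bool (\<bar>z (f i) \<omega>\<bar> > 1)) / N \<partial>M)"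
      using P_int bound_int P_le by (intro integral_mono)
    also have "\<dots> = (\<epsilon> / 2 * (\<integral>\<omega>. \<psi> (z (f i) \<omega>) \<partial>M) + C * (\<integral>\<omega>. of_bool (\<bar>z (f i) \<omega>\<bar> > 1) \<partial>M)) / N"
      using int\<psi> of_bool_int by simp
    also have "\<dots> \<le> (\<epsilon> / 2 * 1 + C * \<delta>) / N"
      using le1 f(2)[OF that] \<epsilon> C by (intro divide_right_mono add_mono mult_left_mono) auto
    finally show ?thesis by simp
  qed
  have Q_int: "integrable M (Q i j)" for i j
    unfolding Q_def abs using int\<psi> by (rule large_part_integrable)
  have Q_integral: "(\<integral>\<omega>. Q i j \<omega> \<partial>M) \<le> \<delta>" if "i < j" "j < N" for i j
    unfolding Q_def abs using that by (rule f(3))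
  have R_int: "integrable M R"
    unfolding R_def using P_int Q_int by simp
  have "(\<integral>\<omega>. R \<omega> \<partial>M) = (\<Sum>i<N. \<integral>\<omega>. P i \<omega> \<partial>M) + (\<Sum>i<N. \<Sum>j\<in>{i<..<N}. \<integral>\<omega>. Q i j \<omega> \<partial>M)"
    unfolding R_def using P_int Q_int by simp
  also have "\<dots> \<le> (\<Sum>i<N. (\<epsilon> / 2 + C * \<delta>) / N) + (\<Sum>i<N. \<Sum>j\<in>{i<..<N}. \<delta>)"
    using P_integral Q_integral by (intro add_mono sum_mono) auto
  also have "\<dots> \<le> (\<epsilon> / 2 + C * \<delta>) + (\<Sum>i<N. \<Sum>j<N. \<delta>)"
    using N \<delta> by (intro add_mono sum_mono sum_mono2) auto
  also have "\<dots> = \<epsilon>" using \<delta>(2) by simp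
  finally have R_integral: "(\<integral>\<omega>. R \<omega> \<partial>M) \<le> \<epsilon>" .
  have R0: "0 \<le> R \<omega>" for \<omega>
    unfolding R_def by (intro add_nonneg_nonneg sum_nonneg P0 Q0)
  \<comment> \<open>The factor 3 in \<open>average_split\<close> is dropped, which is possible since
    \<open>R \<omega>\<close> and \<open>\<psi> 1\<close> are nonnegative.\<close>
  have "\<psi> ((\<Sum>i<N. \<bar>z (f i) \<omega>\<bar>) / N / 3) - \<psi> 1 \<le> R \<omega>" for \<omega>
    using average_split[OF N, of "\<lambda>i. \<bar>z (f i) \<omega>\<bar>"] R0[of \<omega>] nonneg[of 1]
    unfolding R_def P_def Q_def by simp
  then have "(\<integral>\<^sup>+\<omega>. ennreal (\<psi> ((\<Sum>i<N. \<bar>z (f i) \<omega>\<bar>) / N / 3) - \<psi> 1) \<partial>M) \<le> (\<integral>\<^sup>+\<omega>. ennreal (R \<omega>) \<partial>M)"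
    by (intro nn_integral_mono ennreal_leI)
  also have "\<dots> = ennreal (\<integral>\<omega>. R \<omega> \<partial>M)"
    using R_int R0 by (intro nn_integral_eq_integral) auto
  also have "\<dots> \<le> ennreal \<epsilon>"
    using R_integral by (rule ennreal_leI)
  finally show ?thesis using N f(1) by blast
qed

end

text \<open>\<open>W\<close> is a single integrable majorant for all \<open>n\<close>, which is what
  later controls the supremum. The constants \<open>a\<close> and \<open>b\<close> supply the L1
  bound for the selection of a convergent sequence.\<close>

lemma order_bounded_forward_combinations:
  assumes X: "\<And>n. X n \<in> unit_ball"
    and coercive: "\<And>y. \<bar>y\<bar> \<le> a + b * \<psi> y" and b: "b \<ge> 0"
    and growth: "\<And>\<epsilon>. \<epsilon> > 0 \<Longrightarrow> \<exists>N>0. \<exists>C\<ge>0. \<forall>y. real N * \<psi> (y / N) \<le> \<epsilon> * \<psi> y + C"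
  obtains \<eta> \<zeta> W where "\<And>n. \<eta> n \<in> fun_conv {X k |k. k \<ge> n}" "\<And>n. \<eta> n \<in> borel_measurable M"
    "\<zeta> \<in> unit_ball" "AE \<omega> in M. (\<lambda>n. \<eta> n \<omega>) \<longlonglongrightarrow> \<zeta> \<omega>"
    "W \<in> borel_measurable M" "(\<integral>\<^sup>+\<omega>. W \<omega> \<partial>M) < \<infinity>"
    "\<And>n \<omega>. ennreal (\<psi> (\<eta> n \<omega> / 12)) \<le> W \<omega>"
proof -
  define C where "C n = fun_conv {X k |k. k \<ge> n}" for n
  have C_anti: "C n \<subseteq> C m" if "m \<le> n" for m n
    unfolding C_def using that by (intro fun_conv_mono) auto
  have C_ball: "C n \<subseteq> unit_ball" for n
    unfolding C_def using X by (intro fun_conv_unit_ball) auto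
  have ball_int: "integrable M g" "(\<integral>\<omega>. \<bar>g \<omega>\<bar> \<partial>M) \<le> a + b" if "g \<in> unit_ball" for g
  proof -
    have [measurable]: "g \<in> borel_measurable M" and g: "integrable M (\<lambda>\<omega>. \<psi> (g \<omega>))" "(\<integral>\<omega>. \<psi> (g \<omega>) \<partial>M) \<le> 1"
      using that unfolding unit_ball_def by blast+
    then have int: "integrable M (\<lambda>\<omega>. a + b * \<psi> (g \<omega>))" by simp
    show gi: "integrable M g"
      by (rule Bochner_Integration.integrable_bound[OF int])
        (auto intro!: AE_I2 order_trans[OF coercive] abs_ge_self)
    have "(\<integral>\<omega>. \<bar>g \<omega>\<bar> \<partial>M) \<le> (\<integral>\<omega>. a + b * \<psi> (g \<omega>) \<partial>M)"
      using gi int coercive by (intro integral_mono) auto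
    also have "\<dots> = a + b * (\<integral>\<omega>. \<psi> (g \<omega>) \<partial>M)"
      using g by (simp add: prob_space)
    also have "\<dots> \<le> a + b"
      using mult_left_mono[OF g(2) b] by simp
    finally show "(\<integral>\<omega>. \<bar>g \<omega>\<bar> \<partial>M) \<le> a + b" .
  qed
  obtain \<eta>' \<zeta> where \<eta>': "\<And>n. \<eta>' n \<in> C n" and \<zeta> [measurable]: "\<zeta> \<in> borel_measurable M"
    and lim: "AE \<omega> in M. (\<lambda>n. \<eta>' n \<omega>) \<longlonglongrightarrow> \<zeta> \<omega>"
  proof (rule convergent_forward_selection[of C "a + b"])
    show "C n \<noteq> {}" for n
      unfolding C_def using fun_conv_base[of "X n" "{X k |k. k \<ge> n}"] by blast
    show "(\<lambda>\<omega>. (g \<omega> + h \<omega>) / 2) \<in> C n" if "g \<in> C n" "h \<in> C n" for n g h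
      using fun_conv_convex[of g _ h "1/2" "1/2"] that unfolding C_def
      by (simp add: add_divide_distrib)
  qed (use C_anti C_ball ball_int in blast)+
  have \<eta>'_ball: "\<eta>' n \<in> unit_ball" for n
    using \<eta>' C_ball by blast
  then have [measurable]: "\<eta>' n \<in> borel_measurable M" for n
    unfolding unit_ball_def by blast
  have \<zeta>_ball: "\<zeta> \<in> unit_ball"
    using \<eta>'_ball \<zeta> lim by (rule unit_ball_AE_closed)
  \<comment> \<open>The half makes \<open>z n\<close> a convex combination of
    \<open>\<eta>' n\<close> and the negative of \<zeta>, both in the unit ball.\<close>
  define z where "z n \<omega> = (\<eta>' n \<omega> - \<zeta> \<omega>) / 2" for n \<omega>
  have z_ball: "z n \<in> unit_ball" for n
  proof -
    have *: "(\<lambda>\<omega>. - \<zeta> \<omega>) \<in> unit_ball"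
      using \<zeta>_ball by (simp add: unit_ball_def even)
    have "(\<lambda>\<omega>. 1/2 * \<eta>' n \<omega> + 1/2 * (- \<zeta> \<omega>)) \<in> fun_conv {\<eta>' n, \<lambda>\<omega>. - \<zeta> \<omega>}"
      by (intro fun_conv_convex fun_conv_base) auto
    also have "(\<lambda>\<omega>. 1/2 * \<eta>' n \<omega> + 1/2 * (- \<zeta> \<omega>)) = z n"
      by (auto simp: z_def diff_divide_distrib)
    finally show ?thesis
      using fun_conv_unit_ball[of "{\<eta>' n, \<lambda>\<omega>. - \<zeta> \<omega>}"] * \<eta>'_ball by auto
  qed
  have [measurable]: "z n \<in> borel_measurable M" for n
    using z_ball unfolding unit_ball_def by blast
  have z_null: "AE \<omega> in M. (\<lambda>n. z n \<omega>) \<longlonglongrightarrow> 0"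
    using lim
  proof eventually_elim
    case (elim \<omega>)
    have "(\<lambda>n. (\<eta>' n \<omega> - \<zeta> \<omega>) / 2) \<longlonglongrightarrow> (\<zeta> \<omega> - \<zeta> \<omega>) / 2"
      by (intro tendsto_intros elim) simp
    then show ?case by (simp add: z_def)
  qed
  \<comment> \<open>Indices from \<open>n\<close> on keep the averages forward and preserve the
    limit; the bounds \<open>(1/2) ^ n\<close> make the excesses summable.\<close>
  have "\<forall>n. \<exists>N::nat. N > 0 \<and> (\<exists>f::nat \<Rightarrow> nat. (\<forall>i. f i \<ge> n) \<and>
      (\<integral>\<^sup>+\<omega>. ennreal (\<psi> ((\<Sum>i<N. \<bar>z (f i) \<omega>\<bar>) / N / 3) - \<psi> 1) \<partial>M) \<le> ennreal ((1/2) ^ n))"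
    by (intro allI small_excess_average z_ball z_null growth) auto
  then obtain N f where N: "\<And>n. N n > (0::nat)" and f: "\<And>n i. f n i \<ge> n"
    and excess: "\<And>n. (\<integral>\<^sup>+\<omega>. ennreal (\<psi> ((\<Sum>i<N n. \<bar>z (f n i) \<omega>\<bar>) / N n / 3) - \<psi> 1) \<partial>M) \<le> ennreal ((1/2) ^ n)"
    by metis
  define \<eta> where "\<eta> n \<omega> = (\<Sum>i<N n. \<eta>' (f n i) \<omega>) / N n" for n \<omega>
  define e where "e n \<omega> = ennreal (\<psi> ((\<Sum>i<N n. \<bar>z (f n i) \<omega>\<bar>) / N n / 3) - \<psi> 1)" for n \<omega>
  have [measurable]: "e n \<in> borel_measurable M" for n
    unfolding e_def by measurable
  \<comment> \<open>Each excess is at most the sum of all of them, whose expectation is finite; this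
    removes the dependence on \<open>n\<close>.\<close>
  define W where "W \<omega> = ennreal (\<psi> (\<zeta> \<omega>)) + (ennreal (\<psi> 1) + (\<Sum>n. e n \<omega>))" for \<omega>
  show ?thesis
  proof
    show "\<eta> n \<in> fun_conv {X k |k. k \<ge> n}" for n
      unfolding \<eta>_def
      using N \<eta>' C_anti[OF f] by (intro fun_conv_average) (unfold C_def, blast+)
    show "\<eta> n \<in> borel_measurable M" for n
      unfolding \<eta>_def by measurable
    show "AE \<omega> in M. (\<lambda>n. \<eta> n \<omega>) \<longlonglongrightarrow> \<zeta> \<omega>"
      using lim
    proof eventually_elim
      case (elim \<omega>)
      show ?case
      proof (rule LIMSEQ_I)
        fix r :: real assume "r > 0"
        then have "r / 2 > 0" by simp
        then obtain k where k: "\<And>n. n \<ge> k \<Longrightarrow> norm (\<eta>' n \<omega> - \<zeta> \<omega>) < r / 2"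
          using LIMSEQ_D[OF elim] by blast
        have "norm (\<eta> n \<omega> - \<zeta> \<omega>) < r" if "n \<ge> k" for n
        proof -
          have "\<eta> n \<omega> - \<zeta> \<omega> = (\<Sum>i<N n. \<eta>' (f n i) \<omega> - \<zeta> \<omega>) / N n"
            using N[of n] by (simp add: \<eta>_def sum_subtractf diff_divide_distrib)
          also have "\<bar>\<dots>\<bar> \<le> (\<Sum>i<N n. \<bar>\<eta>' (f n i) \<omega> - \<zeta> \<omega>\<bar>) / N n"
            by (simp add: abs_divide divide_right_mono)
          also have "\<dots> \<le> (\<Sum>i<N n. r / 2) / N n"
            using k[OF order_trans[OF that f]] by (intro divide_right_mono sum_mono) (auto intro: less_imp_le)
          also have "\<dots> < r" using N[of n] \<open>r > 0\<close> by simp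
          finally show ?thesis by simp
        qed
        then show "\<exists>k. \<forall>n\<ge>k. norm (\<eta> n \<omega> - \<zeta> \<omega>) < r" by blast
      qed
    qed
    show "W \<in> borel_measurable M" unfolding W_def by measurable
    have "(\<Sum>n. \<integral>\<^sup>+\<omega>. e n \<omega> \<partial>M) \<le> (\<Sum>n. ennreal ((1/2) ^ n))"
      using excess unfolding e_def by (intro suminf_le) auto
    also have "\<dots> < \<infinity>"
      by (subst suminf_ennreal2) (auto intro!: summable_geometric)
    finally have "(\<integral>\<^sup>+\<omega>. (\<Sum>n. e n \<omega>) \<partial>M) < \<infinity>"
      by (subst nn_integral_suminf) auto
    moreover have "(\<integral>\<^sup>+\<omega>. ennreal (\<psi> (\<zeta> \<omega>)) \<partial>M) \<le> 1"
      using \<zeta>_ball by (simp add: unit_ball_nn_integral)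
    ultimately show "(\<integral>\<^sup>+\<omega>. W \<omega> \<partial>M) < \<infinity>"
      unfolding W_def by (auto simp: nn_integral_add emeasure_space_1 intro: le_less_trans)
    show "ennreal (\<psi> (\<eta> n \<omega> / 12)) \<le> W \<omega>" for n \<omega>
    proof -
      let ?t = "(\<Sum>i<N n. \<bar>z (f n i) \<omega>\<bar>) / N n / 3"
      \<comment> \<open>The 12 is a product of three factors: 2 from the halving in
        \<open>z\<close>, 2 from the convex combination below, and 3 from
        \<open>average_split\<close>.\<close>
      have "\<eta> n \<omega> = \<zeta> \<omega> + 2 * ((\<Sum>i<N n. z (f n i) \<omega>) / N n)"
        using N[of n] by (simp add: \<eta>_def z_def sum_subtractf diff_divide_distrib flip: sum_divide_distrib)
      then have "\<psi> (\<eta> n \<omega> / 12) = \<psi> (1/2 * (\<zeta> \<omega> / 6) + 1/2 * ((\<Sum>i<N n. z (f n i) \<omega>) / N n / 3))"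
        by (simp add: add_divide_distrib)
      also have "\<dots> \<le> 1/2 * \<psi> (\<zeta> \<omega> / 6) + 1/2 * \<psi> ((\<Sum>i<N n. z (f n i) \<omega>) / N n / 3)"
        by (intro combine) auto
      also have "\<dots> \<le> \<psi> (\<zeta> \<omega> / 6) + \<psi> ((\<Sum>i<N n. z (f n i) \<omega>) / N n / 3)"
        using nonneg[of "\<zeta> \<omega> / 6"] nonneg[of "(\<Sum>i<N n. z (f n i) \<omega>) / N n / 3"] by linarith
      also have "\<dots> \<le> \<psi> (\<zeta> \<omega>) + \<psi> ?t"
        by (intro add_mono mono) (auto simp: abs_divide sum_nonneg intro!: divide_right_mono)
      \<comment> \<open>\<open>max 0\<close> matches the truncation of negative numbers by
        \<open>ennreal\<close> in \<open>e\<close>.\<close>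
      finally have "\<psi> (\<eta> n \<omega> / 12) \<le> \<psi> (\<zeta> \<omega>) + (\<psi> 1 + max 0 (\<psi> ?t - \<psi> 1))"
        by linarith
      then have "ennreal (\<psi> (\<eta> n \<omega> / 12)) \<le> ennreal (\<psi> (\<zeta> \<omega>) + (\<psi> 1 + max 0 (\<psi> ?t - \<psi> 1)))"
        by (rule ennreal_leI)
      also have "\<dots> = ennreal (\<psi> (\<zeta> \<omega>)) + (ennreal (\<psi> 1) + e n \<omega>)"
        by (simp add: ennreal_plus nonneg e_def ennreal_max_0)
      also have "\<dots> \<le> W \<omega>"
        unfolding W_def using sum_le_suminf[of "\<lambda>n. e n \<omega>" "{n}"] by (intro add_left_mono) auto
      finally show ?thesis .
    qed
  qed (rule \<zeta>_ball)
qed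

end

section \<open>Orlicz spaces\<close>

lemma scaled_orlicz_ball_iff:
  assumes "c > 0"
  shows "x \<in> scaled_orlicz_ball M \<psi> c \<longleftrightarrow>
    x \<in> borel_measurable M \<and> (\<integral>\<^sup>+\<omega>. ennreal (\<psi> (x \<omega> / c)) \<partial>M) \<le> 1"
proof
  assume "x \<in> scaled_orlicz_ball M \<psi> c"
  then show "x \<in> borel_measurable M \<and> (\<integral>\<^sup>+\<omega>. ennreal (\<psi> (x \<omega> / c)) \<partial>M) \<le> 1"
    using assms by (auto simp: scaled_orlicz_ball_def orlicz_ball_def)
next
  assume "x \<in> borel_measurable M \<and> (\<integral>\<^sup>+\<omega>. ennreal (\<psi> (x \<omega> / c)) \<partial>M) \<le> 1"
  then show "x \<in> scaled_orlicz_ball M \<psi> c"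
    unfolding scaled_orlicz_ball_def orlicz_ball_def using assms
    by (intro image_eqI[of _ _ "\<lambda>\<omega>. x \<omega> / c"]) auto
qed

section \<open>Membership, norm bounds and order convergence\<close>

context even_convex
begin

lemma scaled_orlicz_ball_mono:
  assumes "0 < c" "c \<le> d"
  shows "scaled_orlicz_ball M \<psi> c \<subseteq> scaled_orlicz_ball M \<psi> d"
proof
  fix x assume x: "x \<in> scaled_orlicz_ball M \<psi> c"
  have "(\<integral>\<^sup>+\<omega>. ennreal (\<psi> (x \<omega> / d)) \<partial>M) \<le> (\<integral>\<^sup>+\<omega>. ennreal (\<psi> (x \<omega> / c)) \<partial>M)"
    using assms by (intro nn_integral_mono ennreal_leI mono) (auto simp: abs_divide intro!: divide_left_mono)
  then show "x \<in> scaled_orlicz_ball M \<psi> d"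
    using x assms by (auto simp: scaled_orlicz_ball_iff intro: order_trans)
qed

text \<open>By convexity, enlarging the scale by a factor d \<ge> 1 divides the modular by at least
  \<open>d\<close>, so a finite value can be brought below 1.\<close>

lemma orlicz_spaceI:
  assumes [measurable]: "x \<in> borel_measurable M" and c: "c > 0"
    and fin: "(\<integral>\<^sup>+\<omega>. ennreal (\<psi> (x \<omega> / c)) \<partial>M) < \<infinity>"
  shows "x \<in> orlicz_space M \<psi>"
proof -
  obtain r where r: "(\<integral>\<^sup>+\<omega>. ennreal (\<psi> (x \<omega> / c)) \<partial>M) = ennreal r" "0 \<le> r"
    using fin by (cases "\<integral>\<^sup>+\<omega>. ennreal (\<psi> (x \<omega> / c)) \<partial>M") auto
  define d where "d = r + 1"
  have d: "d \<ge> 1" "r \<le> d" using r by (auto simp: d_def)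
  have "\<psi> (x \<omega> / (c * d)) \<le> 1 / d * \<psi> (x \<omega> / c)" for \<omega>
    using scale[of "1 / d" "x \<omega> / c"] d by (simp add: mult.commute)
  then have "(\<integral>\<^sup>+\<omega>. ennreal (\<psi> (x \<omega> / (c * d))) \<partial>M) \<le> (\<integral>\<^sup>+\<omega>. ennreal (1 / d * \<psi> (x \<omega> / c)) \<partial>M)"
    by (intro nn_integral_mono ennreal_leI)
  also have "\<dots> = ennreal (1 / d) * (\<integral>\<^sup>+\<omega>. ennreal (\<psi> (x \<omega> / c)) \<partial>M)"
    using d by (subst nn_integral_cmult[symmetric]) (auto simp: ennreal_mult' simp del: times_divide_eq_left)
  also have "\<dots> = ennreal (r / d)"
    using r d by (simp add: ennreal_mult'[symmetric])
  also have "\<dots> \<le> 1"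
    using r d by (simp add: ennreal_le_1)
  finally have "x \<in> scaled_orlicz_ball M \<psi> (c * d)"
    using c d by (subst scaled_orlicz_ball_iff) auto
  then show ?thesis
    unfolding orlicz_space_def using c d by (intro UN_I[of "c * d"]) auto
qed

text \<open>The norm is an infimum, so for each \<open>n\<close> some admissible scale lies strictly
  below \<open>B + 1\<close>; monotonicity in the scale moves all terms to a common one.\<close>

lemma orlicz_norm_bounded:
  assumes space: "\<And>n. x n \<in> orlicz_space M \<psi>" and norm: "\<And>n. orlicz_norm M \<psi> (x n) \<le> B"
  obtains c where "c > 0" "\<And>n. x n \<in> scaled_orlicz_ball M \<psi> c"
proof
  show "max (B + 1) 1 > 0" by simp
  fix n
  let ?A = "{c. c > 0 \<and> x n \<in> scaled_orlicz_ball M \<psi> c}"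
  have "?A \<noteq> {}" using space[of n] by (auto simp: orlicz_space_def)
  moreover have "bdd_below ?A" by (rule bdd_belowI[of _ 0]) auto
  moreover have "Inf ?A < B + 1" using norm[of n] by (simp add: orlicz_norm_def)
  ultimately obtain c where "c \<in> ?A" "c < B + 1"
    by (subst (asm) cInf_less_iff) auto
  then show "x n \<in> scaled_orlicz_ball M \<psi> (max (B + 1) 1)"
    using scaled_orlicz_ball_mono[of c "max (B + 1) 1" M] by force
qed

text \<open>Where \<open>W\<close> is finite, the sublevel set of \<open>\<psi> (y / c)\<close> at
  height \<open>W \<omega>\<close> is closed and contains all
  \<open>\<bar>\<eta> n \<omega>\<bar>\<close>, hence also their supremum. So \<open>W\<close>
  majorises the modular density of the supremum.\<close>

lemma orlicz_order_convergentI: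
  assumes [measurable]: "\<And>n. \<eta> n \<in> borel_measurable M"
    and lim: "AE \<omega> in M. (\<lambda>n. \<eta> n \<omega>) \<longlonglongrightarrow> \<zeta> \<omega>"
    and W [measurable]: "W \<in> borel_measurable M" and W_fin: "(\<integral>\<^sup>+\<omega>. W \<omega> \<partial>M) < \<infinity>"
    and c: "c > 0" and le: "\<And>n \<omega>. ennreal (\<psi> (\<eta> n \<omega> / c)) \<le> W \<omega>"
  shows "orlicz_order_convergent M \<psi> \<eta> \<zeta>"
proof -
  \<comment> \<open>\<open>real_of_ereal\<close> sends infinity to 0; this concerns only a null set,
    since convergent sequences are bounded.\<close>
  define \<sigma> where "\<sigma> \<omega> = real_of_ereal (SUP n. ereal \<bar>\<eta> n \<omega>\<bar>)" for \<omega>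
  have [measurable]: "\<sigma> \<in> borel_measurable M"
    unfolding \<sigma>_def by measurable
  have sup: "AE \<omega> in M. (SUP n. ereal \<bar>\<eta> n \<omega>\<bar>) = ereal (\<sigma> \<omega>)"
    using lim
  proof eventually_elim
    case (elim \<omega>)
    then have "Bseq (\<lambda>n. \<eta> n \<omega>)"
      by (intro convergent_imp_Bseq) (auto simp: convergent_def)
    then obtain K where "\<And>n. \<bar>\<eta> n \<omega>\<bar> \<le> K"
      by (auto simp: Bseq_def)
    then have "(SUP n. ereal \<bar>\<eta> n \<omega>\<bar>) \<le> ereal K"
      by (intro SUP_least) simp
    moreover have "ereal \<bar>\<eta> 0 \<omega>\<bar> \<le> (SUP n. ereal \<bar>\<eta> n \<omega>\<bar>)"
      by (intro SUP_upper) simp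
    ultimately show ?case
      unfolding \<sigma>_def by (cases "SUP n. ereal \<bar>\<eta> n \<omega>\<bar>") auto
  qed
  have "AE \<omega> in M. W \<omega> \<noteq> \<infinity>"
    using W_fin by (intro nn_integral_PInf_AE) auto
  then have "AE \<omega> in M. ennreal (\<psi> (\<sigma> \<omega> / c)) \<le> W \<omega>"
    using sup
  proof eventually_elim
    case (elim \<omega>)
    obtain w where w: "W \<omega> = ennreal w" "0 \<le> w"
      using elim(1) by (cases "W \<omega>") auto
    let ?S = "range (\<lambda>n. \<bar>\<eta> n \<omega>\<bar>)"
    have "\<bar>\<eta> n \<omega>\<bar> \<le> \<sigma> \<omega>" for n
    proof -
      have "ereal \<bar>\<eta> n \<omega>\<bar> \<le> (SUP n. ereal \<bar>\<eta> n \<omega>\<bar>)" by (intro SUP_upper) simp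
      then show ?thesis by (simp add: elim(2))
    qed
    then have bdd: "bdd_above ?S" by (intro bdd_aboveI) auto
    have "ereal (Sup ?S) = (SUP n. ereal \<bar>\<eta> n \<omega>\<bar>)"
      using elim(2) by (subst ereal_Sup) (auto simp: image_image)
    then have \<sigma>: "\<sigma> \<omega> = Sup ?S" using elim(2) by simp
    have "closed {y. \<psi> (y / c) \<le> w}"
      by (intro closed_Collect_le continuous_on_compose2[OF continuous[of UNIV]] continuous_intros)
        (use c in auto)
    moreover have "?S \<subseteq> {y. \<psi> (y / c) \<le> w}"
    proof clarify
      fix n
      have "\<psi> (\<bar>\<eta> n \<omega>\<bar> / c) = \<psi> (\<eta> n \<omega> / c)"
        using c abs[of "\<eta> n \<omega> / c"] by (simp add: abs_divide)
      then show "\<psi> (\<bar>\<eta> n \<omega>\<bar> / c) \<le> w"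
        using le[of n \<omega>] w by (simp add: ennreal_le_iff)
    qed
    ultimately have "\<sigma> \<omega> \<in> {y. \<psi> (y / c) \<le> w}"
      unfolding \<sigma> using bdd by (intro closed_subset_contains_Sup) auto
    then show ?case using w by (simp add: ennreal_leI)
  qed
  then have "(\<integral>\<^sup>+\<omega>. ennreal (\<psi> (\<sigma> \<omega> / c)) \<partial>M) \<le> (\<integral>\<^sup>+\<omega>. W \<omega> \<partial>M)"
    by (rule nn_integral_mono_AE)
  then have "\<sigma> \<in> orlicz_space M \<psi>"
    using c W_fin by (intro orlicz_spaceI[of _ _ c]) auto
  then show ?thesis
    unfolding orlicz_order_convergent_def using sup lim by blast
qed

end

theorem corollary3p10:
  fixes M :: "'a measure" and \<Phi> :: "real \<Rightarrow> real" and \<xi> :: "nat \<Rightarrow> 'a \<Rightarrow> real"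
  assumes "prob_space M"
    and "young_function \<Phi>"
    and "Delta2 \<Phi>"
    and "\<forall>n. \<xi> n \<in> orlicz_space M (young_conjugate \<Phi>)"
    and "\<exists>C. \<forall>n. orlicz_norm M (young_conjugate \<Phi>) (\<xi> n) \<le> C"
  shows "\<exists>\<eta> \<zeta>. (\<forall>n. \<eta> n \<in> fun_conv {\<xi> k |k. k \<ge> n}) \<and>
           \<zeta> \<in> orlicz_space M (young_conjugate \<Phi>) \<and>
           orlicz_order_convergent M (young_conjugate \<Phi>) \<eta> \<zeta>"
proof -
  let ?\<Psi> = "young_conjugate \<Phi>"
  interpret \<Psi>: even_convex ?\<Psi>
    using assms(2) by (rule young_conjugate_even_convex)
  obtain c where c: "c > 0" "\<And>n. \<xi> n \<in> scaled_orlicz_ball M ?\<Psi> c"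
    using \<Psi>.orlicz_norm_bounded[of \<xi> M] assms(4,5) by blast
  \<comment> \<open>Dividing by the common scale \<open>c\<close> inside the conjugate puts the
    unscaled sequence into the unit ball.\<close>
  interpret prob: even_convex_prob M "\<lambda>x. ?\<Psi> (x / c)"
    by (rule even_convex_prob.intro[OF assms(1) \<Psi>.rescale[OF c(1)]])
  obtain \<eta> \<zeta> W where \<eta>: "\<And>n. \<eta> n \<in> fun_conv {\<xi> k |k. k \<ge> n}"
    and meas: "\<And>n. \<eta> n \<in> borel_measurable M" "W \<in> borel_measurable M"
    and \<zeta>: "\<zeta> \<in> prob.unit_ball" and lim: "AE \<omega> in M. (\<lambda>n. \<eta> n \<omega>) \<longlonglongrightarrow> \<zeta> \<omega>"
    and W: "(\<integral>\<^sup>+\<omega>. W \<omega> \<partial>M) < \<infinity>" "\<And>n \<omega>. ennreal (?\<Psi> (\<eta> n \<omega> / 12 / c)) \<le> W \<omega>"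
  proof (rule prob.order_bounded_forward_combinations[of \<xi> "c * \<Phi> 1" c])
    show "\<xi> n \<in> prob.unit_ball" for n
      using c by (simp add: prob.unit_ball_nn_integral scaled_orlicz_ball_iff)
    show "\<bar>y\<bar> \<le> c * \<Phi> 1 + c * ?\<Psi> (y / c)" for y
      using abs_le_young_conjugate[OF assms(2), of "y / c"] c(1) by (simp add: abs_divide field_simps)
    show "\<exists>N>0. \<exists>C\<ge>0. \<forall>y. real N * ?\<Psi> (y / N / c) \<le> \<epsilon> * ?\<Psi> (y / c) + C" if "\<epsilon> > 0" for \<epsilon>
    proof -
      obtain N :: nat and C where N: "N > 0" "C \<ge> 0" "\<And>y. N * ?\<Psi> (y / N) \<le> \<epsilon> * ?\<Psi> y + C"
        using young_conjugate_growth[OF assms(2,3) \<open>\<epsilon> > 0\<close>] by blast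
      have "N * ?\<Psi> (y / N / c) \<le> \<epsilon> * ?\<Psi> (y / c) + C" for y
        using N(3)[of "y / c"] by (simp add: mult.commute)
      with N(1,2) show ?thesis by blast
    qed
  qed (use c in auto)
  have "\<zeta> \<in> orlicz_space M ?\<Psi>"
    using \<zeta> c(1) by (intro \<Psi>.orlicz_spaceI[of _ _ c])
      (auto simp: prob.unit_ball_nn_integral intro: le_less_trans)
  \<comment> \<open>The scale \<open>12 * c\<close> combines the 12 of the majorant with the initial
    rescaling.\<close>
  moreover have "orlicz_order_convergent M ?\<Psi> \<eta> \<zeta>"
    using meas lim W c(1) by (intro \<Psi>.orlicz_order_convergentI[of _ _ _ W "12 * c"]) auto
  ultimately show ?thesis using \<eta> by blast
qed

end
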